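(* Let $q$ be a prime power, $n$ a positive integer and $k'$ a positive integer. Let $L_U$ be an $\mathbb{F}_q$-linear set in $\mathrm{PG}(1,q^n)$ of rank $k=k'+2$ having a point of weight $k'$. Then $L_U$ has minimum size, i.e. $L_U$ contains a point of weight one and $|L_U|=q^{k'+1}+1$, if and only if, up to the action of $\mathrm{GL}(2,q^n)$ (i.e. after replacing $U$ by $\varphi(U)$ for a suitable $\varphi\in\mathrm{GL}(2,q^n)$), we have $U=S\times T$, where $S$ is a $k'$-dimensional $\mathbb{F}_q$-subspace of $\mathbb{F}_{q^n}$ and $T=\langle 1,\mu\rangle_{\mathbb{F}_q}$ for some $\mu\in\mathbb{F}_{q^n}\setminus\mathbb{F}_q$ with $\mathbb{F}_q(\mu)=\mathbb{F}_{q^t}$, and one of the following occurs: 1. $t>k'$ and $S=b\langle 1,\mu,\ldots,\mu^{k'-1}\rangle_{\mathbb{F}_q}$ for some $b\in\mathbb{F}_{q^n}^*$; 2. $t\le k'-1$, and writing $k'=t\ell+m$ with $0\le m<t$, one has $m>0$ and $S=\overline{S}\oplus b\langle 1,\mu,\ldots,\mu^{m-1}\rangle_{\mathbb{F}_q}$, where $\overline{S}$ is an $\mathbb{F}_{q^t}$-subspace of $\mathbb{F}_{q^n}$ of dimension $\ell$ over $\mathbb{F}_{q^t}$, $b\in\mathbb{F}_{q^n}^*$ and $\overline{S}\cap b\mathbb{F}_{q^t}=\{0\}$. In particular, if $n$ is prime, then every $\mathbb{F}_q$-linear set of rank $k'+2$ in $\mathrm{PG}(1,q^n)$ of minimum size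 $q^{k'+1}+1$ having a point of weight $k'$ is, up to the action of $\mathrm{GL}(2,q^n)$, a linear set $L_W$ with $W=\langle 1,\lambda,\ldots,\lambda^{t_1-1}\rangle_{\mathbb{F}_q}\times\langle 1,\lambda,\ldots,\lambda^{t_2-1}\rangle_{\mathbb{F}_q}$ for some $\lambda\in\mathbb{F}_{q^n}\setminus\mathbb{F}_q$, where $\{t_1,t_2\}=\{2,k'\}$ and $t_1+t_2\le n+1$.
   Context: For an $\mathbb{F}_q$-subspace $U\neq\{0\}$ of $\mathbb{F}_{q^n}^2$, the $\mathbb{F}_q$-linear set $L_U=\{\langle u\rangle_{\mathbb{F}_{q^n}}: u\in U\setminus\{0\}\}\subseteq\mathrm{PG}(1,q^n)$ has rank $\dim_{\mathbb{F}_q}U$. The weight of a point $P=\langle v\rangle_{\mathbb{F}_{q^n}}$ in $L_U$ is $w_{L_U}(P)=\dim_{\mathbb{F}_q}(U\cap\langle v\rangle_{\mathbb{F}_{q^n}})$. For subsets $S,T\subseteq\mathbb{F}_{q^n}$, $S\times T=\{(s,t):s\in S,t\in T\}$. An $\mathbb{F}_q$-linear set of rank $k$ in $\mathrm{PG}(1,q^n)$ is said to have minimum size if it has at least one point of weight one and exactly $q^{k-1}+1$ points. $\mathrm{GL}(2,q^n)$ acts on $\mathbb{F}_{q^n}^2$ and hence on $\mathbb{F}_q$-subspaces and linear sets. *)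

theory Defs
  imports
    "HOL-Analysis.Product_Vector"
    "HOL-Library.Cardinality"
    "HOL-Library.Set_Algebras"
    "HOL-Number_Theory.Prime_Powers"
begin

text \<open>
  The field with \<open>q ^ n\<close> elements is a type \<open>'a :: {field, finite}\<close>; its subfields are subsets of
  that type. Since linear algebra is needed over several such subfields (which are not types),
  subspace, span, independence and dimension are taken relative to a set \<open>K\<close> of scalars, copying
  the definitions of the locale \<^locale>\<open>vector_space\<close>. The parameter \<open>s\<close> is the scalar
  multiplication: \<open>(*)\<close> on the field itself, \<open>plane.scale\<close> on the plane \<open>'a \<times> 'a\<close>.
\<close>

interpretation plane: vector_space_prod "(*) :: 'a \<Rightarrow> 'a \<Rightarrow> 'a::field" "(*) :: 'a \<Rightarrow> 'a \<Rightarrow> 'a"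
  by unfold_locales (auto simp: algebra_simps)

definition is_subfield :: "'a::field set \<Rightarrow> bool" where
  "is_subfield K \<longleftrightarrow> 0 \<in> K \<and> 1 \<in> K \<and>
     (\<forall>x\<in>K. \<forall>y\<in>K. x + y \<in> K \<and> x * y \<in> K) \<and> (\<forall>x\<in>K. - x \<in> K \<and> inverse x \<in> K)"

definition adjoin :: "'a::field set \<Rightarrow> 'a \<Rightarrow> 'a set" where
  "adjoin K \<mu> = is_subfield hull (insert \<mu> K)"

definition subspace_over :: "('a::field \<Rightarrow> 'v::ab_group_add \<Rightarrow> 'v) \<Rightarrow> 'a set \<Rightarrow> 'v set \<Rightarrow> bool" where
  "subspace_over s K V \<longleftrightarrow>
     0 \<in> V \<and> (\<forall>x\<in>V. \<forall>y\<in>V. x + y \<in> V) \<and> (\<forall>c\<in>K. \<forall>x\<in>V. s c x \<in> V)"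

definition span_over :: "('a::field \<Rightarrow> 'v::ab_group_add \<Rightarrow> 'v) \<Rightarrow> 'a set \<Rightarrow> 'v set \<Rightarrow> 'v set" where
  "span_over s K B = subspace_over s K hull B"

definition independent_over :: "('a::field \<Rightarrow> 'v::ab_group_add \<Rightarrow> 'v) \<Rightarrow> 'a set \<Rightarrow> 'v set \<Rightarrow> bool" where
  "independent_over s K B \<longleftrightarrow>
     (\<forall>A c. finite A \<and> A \<subseteq> B \<and> c ` A \<subseteq> K \<and> (\<Sum>v\<in>A. s (c v) v) = 0 \<longrightarrow> (\<forall>v\<in>A. c v = 0))"

text \<open>Only meaningful when \<open>K\<close> is a subfield and \<open>V\<close> a \<open>K\<close>-subspace.\<close>

definition dim_over :: "('a::field \<Rightarrow> 'v::ab_group_add \<Rightarrow> 'v) \<Rightarrow> 'a set \<Rightarrow> 'v set \<Rightarrow> nat" where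
  "dim_over s K V = card (SOME B. independent_over s K B \<and> span_over s K B = V)"

definition direct_sum_of :: "'v::ab_group_add set \<Rightarrow> 'v set \<Rightarrow> 'v set \<Rightarrow> bool" where
  "direct_sum_of S A B \<longleftrightarrow> S = A + B \<and> A \<inter> B = {0}"

definition power_span :: "'a::field set \<Rightarrow> 'a \<Rightarrow> nat \<Rightarrow> 'a set" where
  "power_span K \<mu> m = span_over (*) K ((\<lambda>i. \<mu> ^ i) ` {..<m})"

definition GL2 :: "('a::field \<times> 'a \<Rightarrow> 'a \<times> 'a) set" where
  "GL2 = {\<phi>. Vector_Spaces.linear plane.scale plane.scale \<phi> \<and> bij \<phi>}"

text \<open>A point of the projective line is represented by the one-dimensional subspace it is.\<close>

definition linear_set :: "('a::field \<times> 'a) set \<Rightarrow> ('a \<times> 'a) set set" where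
  "linear_set U = {plane.p.span {u} | u. u \<in> U - {0}}"

definition weight :: "'a::field set \<Rightarrow> ('a \<times> 'a) set \<Rightarrow> ('a \<times> 'a) set \<Rightarrow> nat" where
  "weight K U P = dim_over plane.scale K (U \<inter> P)"

definition rank_of :: "'a::field set \<Rightarrow> ('a \<times> 'a) set \<Rightarrow> nat" where
  "rank_of K U = dim_over plane.scale K U"

text \<open>
  Rank and weights depend on the underlying subspace and not just on the set of points, so these
  notions are properties of \<open>U\<close>. For \<open>K\<close> of order \<open>q\<close> and rank \<open>k\<close>, the size is \<open>q ^ (k - 1) + 1\<close>.
\<close>

definition has_minimum_size :: "'a::field set \<Rightarrow> ('a \<times> 'a) set \<Rightarrow> bool" where
  "has_minimum_size K U \<longleftrightarrow>
     (\<exists>P\<in>linear_set U. weight K U P = 1) \<and>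
     card (linear_set U) = card K ^ (rank_of K U - 1) + 1"

end

theory Submission
  imports Defs
begin

text \<open>
  Let \<open>P\<close> be the point of weight \<open>k'\<close>. All other points have weight one or two, and counting the nonzero
  vectors of \<open>U\<close> shows that \<open>L\<^sub>U\<close> has minimum size iff exactly \<open>q ^ (k' - 1)\<close> of them have weight
  two. Moving \<open>P\<close> and one point of weight two to the coordinate axes turns \<open>U\<close> into \<open>S \<times> \<langle>1, \<mu>\<rangle>\<close>, whose
  points of weight two correspond to the \<open>x \<in> S\<close> with \<open>\<mu> * x \<in> S\<close>. So the condition says that these \<open>x\<close>
  form a hyperplane of \<open>S\<close>. Iterating \<open>S \<mapsto> {x \<in> S. \<mu> * x \<in> S}\<close> then drops the dimension by one at a time
  until a \<open>\<mu>\<close>-invariant subspace \<open>A\<close> is reached, and \<open>S = A \<oplus> b\<langle>1, \<mu>, \<dots>, \<mu> ^ (m - 1)\<rangle>\<close>.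
\<close>

section \<open>Linear algebra over a subfield\<close>

text \<open>This instance of the rule says \<open>a * (b * c) = a * b * c\<close>, which loops together with \<open>mult.assoc\<close>.\<close>

declare plane.vs1.scale_scale [simp del]

lemma is_subfieldD:
  assumes "is_subfield K"
  shows "0 \<in> K" "1 \<in> K" "x \<in> K \<Longrightarrow> y \<in> K \<Longrightarrow> x + y \<in> K" "x \<in> K \<Longrightarrow> y \<in> K \<Longrightarrow> x * y \<in> K"
    "x \<in> K \<Longrightarrow> - x \<in> K" "x \<in> K \<Longrightarrow> inverse x \<in> K" "x \<in> K \<Longrightarrow> y \<in> K \<Longrightarrow> x - y \<in> K"
  using assms unfolding is_subfield_def by (auto simp: diff_conv_add_uminus simp del: add_uminus_conv_diff)

lemma card_subfield_gt_1:
  fixes K :: "'a::{field, finite} set"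
  assumes "is_subfield K"
  shows "card K > 1"
proof -
  have "card {0, 1::'a} \<le> card K"
    using is_subfieldD(1,2)[OF assms] by (intro card_mono) auto
  thus ?thesis by simp
qed

lemma subspace_overD:
  assumes "subspace_over s K V"
  shows "0 \<in> V" "x \<in> V \<Longrightarrow> y \<in> V \<Longrightarrow> x + y \<in> V" "c \<in> K \<Longrightarrow> x \<in> V \<Longrightarrow> s c x \<in> V"
  using assms unfolding subspace_over_def by auto

lemma span_over_least: "B \<subseteq> V \<Longrightarrow> subspace_over s K V \<Longrightarrow> span_over s K B \<subseteq> V"
  unfolding span_over_def by (rule hull_minimal)

lemma span_over_superset: "B \<subseteq> span_over s K B"
  unfolding span_over_def by (rule hull_subset)

lemma subspace_over_span: "subspace_over s K (span_over s K B)"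
  unfolding span_over_def hull_def subspace_over_def by blast

lemma subspace_over_Int:
  "subspace_over s K V \<Longrightarrow> subspace_over s K W \<Longrightarrow> subspace_over s K (V \<inter> W)"
  unfolding subspace_over_def by auto

text \<open>One setting for the field over \<open>K\<close> and the plane over \<open>K\<close>.
  Both types are finite, so every generating set is finite and dimensions can be read off from
  cardinalities.\<close>

locale subfield_space = vector_space scale
  for scale :: "'a::{field, finite} \<Rightarrow> 'v::{ab_group_add, finite} \<Rightarrow> 'v" (infixr "*s" 75) +
  fixes K :: "'a set"
  assumes subfield: "is_subfield K"
begin

lemma subspace_over_uminus: "subspace_over scale K V \<Longrightarrow> x \<in> V \<Longrightarrow> - x \<in> V"
  using subspace_overD(3)[of scale K V "-1" x] is_subfieldD(2,5)[OF subfield] by auto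

lemma subspace_over_diff: "subspace_over scale K V \<Longrightarrow> x \<in> V \<Longrightarrow> y \<in> V \<Longrightarrow> x - y \<in> V"
  using subspace_overD(2)[of scale K V x "- y"] subspace_over_uminus by auto

lemma span_over_insert:
  "span_over scale K (insert v B) = {x + c *s v | x c. x \<in> span_over scale K B \<and> c \<in> K}"
  (is "_ = ?S")
proof
  have sp: "subspace_over scale K (span_over scale K B)" by (rule subspace_over_span)
  have "subspace_over scale K ?S"
    unfolding subspace_over_def
  proof (intro conjI ballI)
    show "0 \<in> ?S"
      using subspace_overD(1)[OF sp] is_subfieldD(1)[OF subfield] by force
  next
    fix x y assume "x \<in> ?S" "y \<in> ?S"
    then obtain x' c y' d where "x = x' + c *s v" "y = y' + d *s v"
      "x' \<in> span_over scale K B" "y' \<in> span_over scale K B" "c \<in> K" "d \<in> K" by blast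
    moreover have "x + y = (x' + y') + (c + d) *s v"
      using calculation by (simp add: algebra_simps)
    ultimately show "x + y \<in> ?S"
      using subspace_overD(2)[OF sp] is_subfieldD(3)[OF subfield] by blast
  next
    fix d x assume "d \<in> K" "x \<in> ?S"
    then obtain x' c where "x = x' + c *s v" "x' \<in> span_over scale K B" "c \<in> K" by blast
    moreover have "d *s x = d *s x' + (d * c) *s v"
      using calculation by (simp add: algebra_simps)
    ultimately show "d *s x \<in> ?S"
      using subspace_overD(3)[OF sp] is_subfieldD(4)[OF subfield] \<open>d \<in> K\<close> by blast
  qed
  moreover have "insert v B \<subseteq> ?S"
  proof
    fix x assume "x \<in> insert v B"
    thus "x \<in> ?S"
    proof
      assume "x = v"
      hence "x = 0 + 1 *s v" by simp
      thus ?thesis using subspace_overD(1)[OF sp] is_subfieldD(2)[OF subfield] by blast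
    next
      assume "x \<in> B"
      moreover have "x = x + 0 *s v" by simp
      ultimately show ?thesis using span_over_superset is_subfieldD(1)[OF subfield] by blast
    qed
  qed
  ultimately show "span_over scale K (insert v B) \<subseteq> ?S" by (intro span_over_least)
next
  have sp: "subspace_over scale K (span_over scale K (insert v B))" by (rule subspace_over_span)
  have "span_over scale K B \<subseteq> span_over scale K (insert v B)"
    unfolding span_over_def by (intro hull_mono) auto
  moreover have "v \<in> span_over scale K (insert v B)"
    using span_over_superset by blast
  ultimately show "?S \<subseteq> span_over scale K (insert v B)"
    using subspace_overD(2,3)[OF sp] by blast
qed

lemma span_over_empty: "span_over scale K {} = {0}"
proof -
  have "subspace_over scale K {0}" by (auto simp: subspace_over_def)
  hence "span_over scale K {} \<subseteq> {0}" by (intro span_over_least) auto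
  thus ?thesis using subspace_overD(1)[OF subspace_over_span] by blast
qed

text \<open>Links the hull to linear combinations, the language of \<open>independent_over\<close>.
  As \<open>B\<close> is finite, coefficients can be given on all of \<open>B\<close>.\<close>

lemma span_over_eq_sums:
  "span_over scale K B = {\<Sum>v\<in>B. c v *s v | c. c ` B \<subseteq> K}"
proof (induction B rule: finite_induct[OF finite])
  case 1
  show ?case by (auto simp: span_over_empty)
next
  case (2 v B)
  show ?case
  proof (intro equalityI subsetI)
    fix x assume "x \<in> span_over scale K (insert v B)"
    then obtain c d where c: "x = (\<Sum>w\<in>B. c w *s w) + d *s v" "c ` B \<subseteq> K" "d \<in> K"
      unfolding span_over_insert 2 by blast
    have "(\<Sum>w\<in>insert v B. (c(v := d)) w *s w) = d *s v + (\<Sum>w\<in>B. (c(v := d)) w *s w)"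
      using 2 by simp
    also have "(\<Sum>w\<in>B. (c(v := d)) w *s w) = (\<Sum>w\<in>B. c w *s w)"
      using 2 by (intro sum.cong) auto
    finally have "x = (\<Sum>w\<in>insert v B. (c(v := d)) w *s w)" using c by simp
    moreover have "(c(v := d)) ` insert v B \<subseteq> K" using c by auto
    ultimately show "x \<in> {\<Sum>v\<in>insert v B. c v *s v | c. c ` insert v B \<subseteq> K}" by blast
  next
    fix x assume "x \<in> {\<Sum>v\<in>insert v B. c v *s v | c. c ` insert v B \<subseteq> K}"
    then obtain c where "x = (\<Sum>w\<in>B. c w *s w) + c v *s v" "c ` B \<subseteq> K" "c v \<in> K"
      using 2 by (auto simp: add.commute)
    thus "x \<in> span_over scale K (insert v B)"
      unfolding span_over_insert 2 by blast
  qed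
qed

section \<open>Linear independence over the subfield\<close>

lemma independent_overD:
  assumes "independent_over scale K B" "c ` B \<subseteq> K" "(\<Sum>v\<in>B. c v *s v) = 0" "v \<in> B"
  shows "c v = 0"
  using assms unfolding independent_over_def by (meson finite order_refl)

text \<open>A relation on a subset of \<open>B\<close> extends by zero coefficients, so it suffices
  to test relations on the whole of \<open>B\<close>.\<close>

lemma independent_overI:
  assumes "\<And>c v. c ` B \<subseteq> K \<Longrightarrow> (\<Sum>v\<in>B. c v *s v) = 0 \<Longrightarrow> v \<in> B \<Longrightarrow> c v = 0"
  shows "independent_over scale K B"
  unfolding independent_over_def
proof (intro allI impI ballI, elim conjE)
  fix A c v assume A: "A \<subseteq> B" "c ` A \<subseteq> K" "(\<Sum>v\<in>A. c v *s v) = 0" "v \<in> A"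
  define d where "d v = (if v \<in> A then c v else 0)" for v
  have "(\<Sum>v\<in>B. d v *s v) = (\<Sum>v\<in>A. c v *s v)"
    using A by (intro sum.mono_neutral_cong_right) (auto simp: d_def)
  moreover have "d ` B \<subseteq> K" using A is_subfieldD(1)[OF subfield] by (auto simp: d_def)
  ultimately have "d v = 0" using assms A by auto
  thus "c v = 0" using A by (simp add: d_def)
qed

lemma independent_over_insert:
  assumes "v \<notin> B"
  shows "independent_over scale K (insert v B) \<longleftrightarrow>
    independent_over scale K B \<and> v \<notin> span_over scale K B"
proof (intro iffI conjI notI)
  assume ind: "independent_over scale K (insert v B)"
  thus "independent_over scale K B"
    unfolding independent_over_def by (meson subset_insertI2)
  assume "v \<in> span_over scale K B"
  then obtain c where c: "v = (\<Sum>w\<in>B. c w *s w)" "c ` B \<subseteq> K"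
    unfolding span_over_eq_sums by blast
  \<comment> \<open>The coefficient -1 at \<open>v\<close> turns the expression of \<open>v\<close>
    by \<open>B\<close> into a nontrivial relation.\<close>
  have "(\<Sum>w\<in>insert v B. (c(v := - 1)) w *s w) = - v + (\<Sum>w\<in>B. (c(v := -1)) w *s w)"
    using assms by simp
  also have "(\<Sum>w\<in>B. (c(v := - 1)) w *s w) = (\<Sum>w\<in>B. c w *s w)"
    using assms by (intro sum.cong) auto
  finally have "(\<Sum>w\<in>insert v B. (c(v := - 1)) w *s w) = 0" using c by simp
  moreover have "(c(v := - 1)) ` insert v B \<subseteq> K"
    using c is_subfieldD(2,5)[OF subfield] by auto
  ultimately have "(c(v := - 1)) v = 0" using independent_overD[OF ind] by blast
  thus False by simp
next
  assume *: "independent_over scale K B \<and> v \<notin> span_over scale K B"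
  show "independent_over scale K (insert v B)"
  proof (rule independent_overI)
    fix c w assume c: "c ` insert v B \<subseteq> K" "(\<Sum>v\<in>insert v B. c v *s v) = 0" "w \<in> insert v B"
    have sum: "(\<Sum>w\<in>B. c w *s w) = - (c v *s v)"
      using c assms by (simp add: eq_neg_iff_add_eq_0 add.commute)
    \<comment> \<open>Otherwise division by \<open>c v\<close>, possible inside \<open>K\<close>,
      would put \<open>v\<close> into the span of \<open>B\<close>.\<close>
    have "c v = 0"
    proof (rule ccontr)
      assume cv: "c v \<noteq> 0"
      have sp: "subspace_over scale K (span_over scale K B)" by (rule subspace_over_span)
      have "(\<Sum>w\<in>B. c w *s w) \<in> span_over scale K B"
        unfolding span_over_eq_sums using c by blast
      hence "(- inverse (c v)) *s (\<Sum>w\<in>B. c w *s w) \<in> span_over scale K B"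
        using c is_subfieldD(5,6)[OF subfield] by (intro subspace_overD(3)[OF sp]) auto
      thus False using * cv unfolding sum by simp
    qed
    moreover from this have "w \<in> B \<Longrightarrow> c w = 0"
      using independent_overD[of B c w] * sum c by auto
    ultimately show "c w = 0" using c by auto
  qed
qed

text \<open>Two representations of a vector with different scalars would exhibit \<open>v\<close> as
  a \<open>K\<close>-multiple of an element of \<open>W\<close>, so representations are
  unique.\<close>

lemma card_subspace_extend:
  assumes W: "subspace_over scale K W" and "v \<notin> W"
  shows "card {x + c *s v | x c. x \<in> W \<and> c \<in> K} = card K * card W"
proof -
  have "inj_on (\<lambda>(c, x). x + c *s v) (K \<times> W)"
  proof (rule inj_onI, clarify)
    fix c x d y assume *: "c \<in> K" "x \<in> W" "d \<in> K" "y \<in> W" "x + c *s v = y + d *s v"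
    have eq: "(c - d) *s v = y - x" using * by (simp add: algebra_simps)
    have "c = d"
    proof (rule ccontr)
      assume "c \<noteq> d"
      hence "v = inverse (c - d) *s (y - x)" using eq[symmetric] by simp
      moreover have "inverse (c - d) *s (y - x) \<in> W"
        using * is_subfieldD(6,7)[OF subfield]
        by (intro subspace_overD(3)[OF W] subspace_over_diff[OF W]) auto
      ultimately show False using assms by simp
    qed
    thus "c = d \<and> x = y" using * by simp
  qed
  moreover have "{x + c *s v | x c. x \<in> W \<and> c \<in> K} = (\<lambda>(c, x). x + c *s v) ` (K \<times> W)" by auto
  ultimately show ?thesis by (simp add: card_image card_cartesian_product)
qed

lemma card_span_independent:
  "independent_over scale K B \<Longrightarrow> card (span_over scale K B) = card K ^ card B"
proof (induction B rule: finite_induct[OF finite])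
  case 1
  show ?case by (simp add: span_over_empty)
next
  case (2 v B)
  thus ?case
    unfolding span_over_insert
    by (subst card_subspace_extend) (auto simp: independent_over_insert subspace_over_span)
qed

text \<open>An independent subset of \<open>V\<close> of largest size spans \<open>V\<close>. This
  existence gives the choice in \<open>dim_over\<close> its meaning.\<close>

lemma exists_basis:
  assumes "subspace_over scale K V"
  shows "\<exists>B. independent_over scale K B \<and> span_over scale K B = V"
proof -
  define I where "I = {B. B \<subseteq> V \<and> independent_over scale K B}"
  have "{} \<in> I" by (auto simp: I_def independent_over_def)
  moreover have "\<forall>B. B \<in> I \<longrightarrow> card B < Suc CARD('v)" by (simp add: card_mono less_Suc_eq_le)
  ultimately have "\<exists>B. B \<in> I \<and> (\<forall>C. C \<in> I \<longrightarrow> card C \<le> card B)"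
    using ex_has_greatest_nat[of "\<lambda>B. B \<in> I" "{}" card "Suc CARD('v)"] by simp
  then obtain B where B: "B \<in> I" "\<And>C. C \<in> I \<Longrightarrow> card C \<le> card B" by blast
  have "V \<subseteq> span_over scale K B"
  proof
    fix v assume v: "v \<in> V"
    show "v \<in> span_over scale K B"
    proof (rule ccontr)
      assume nv: "v \<notin> span_over scale K B"
      hence nB: "v \<notin> B" using span_over_superset by blast
      have "insert v B \<in> I" using B nv nB v independent_over_insert by (auto simp: I_def)
      hence "card (insert v B) \<le> card B" using B by blast
      thus False using nB by simp
    qed
  qed
  moreover have "span_over scale K B \<subseteq> V"
    using B assms by (intro span_over_least) (auto simp: I_def)
  ultimately show ?thesis using B by (auto simp: I_def)
qed

lemma card_subspace_over:
  assumes "subspace_over scale K V"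
  shows "card V = card K ^ dim_over scale K V"
  unfolding dim_over_def using someI_ex[OF exists_basis[OF assms]] card_span_independent by metis

text \<open>Powers of \<open>card K > 1\<close> determine their exponents, so statements about rank,
  weight and dimension become statements about cardinality.\<close>

lemma dim_over_eq_iff:
  assumes "subspace_over scale K V"
  shows "dim_over scale K V = d \<longleftrightarrow> card V = card K ^ d"
  using card_subspace_over[OF assms] card_subfield_gt_1[OF subfield] by simp

text \<open>The extension of \<open>W\<close> by \<open>v\<close> lies in \<open>V\<close> and has
  as many elements as \<open>V\<close>.\<close>

lemma codim_1_spanning:
  assumes W: "subspace_over scale K W" and V: "subspace_over scale K V" and "W \<subseteq> V" "v \<in> V" "v \<notin> W"
    and card: "card V = card K * card W"
  shows "V = {x + c *s v | x c. x \<in> W \<and> c \<in> K}"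
proof (rule card_subset_eq[symmetric])
  show "{x + c *s v | x c. x \<in> W \<and> c \<in> K} \<subseteq> V"
    using assms subspace_overD(2,3)[OF V] by blast
qed (simp_all add: card_subspace_extend assms)

lemma card_direct_sum:
  assumes A: "subspace_over scale K A" and B: "subspace_over scale K B" and "A \<inter> B = {0}"
  shows "card (A + B) = card A * card B"
proof -
  have "inj_on (\<lambda>(x, y). x + y) (A \<times> B)"
  proof (rule inj_onI, clarify)
    fix x y x' y' assume *: "x \<in> A" "y \<in> B" "x' \<in> A" "y' \<in> B" "x + y = x' + y'"
    hence eq: "x - x' = y' - y" by (simp add: algebra_simps)
    have "x - x' \<in> A \<inter> B"
      using subspace_over_diff[OF A, of x x'] subspace_over_diff[OF B, of y' y] * eq by auto
    thus "x = x' \<and> y = y'" using assms(3) * by auto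
  qed
  moreover have "A + B = (\<lambda>(x, y). x + y) ` (A \<times> B)" by (auto simp: set_plus_def)
  ultimately show ?thesis by (simp add: card_image card_cartesian_product)
qed

end

section \<open>Subspaces that are almost invariant under multiplication by an element\<close>

text \<open>Finiteness supplies the inverses: multiplication by a nonzero \<open>x\<close> is
  injective on \<open>A\<close>, hence onto, and so reaches 1.\<close>

lemma is_subfield_finiteI:
  fixes A :: "'a::{field, finite} set"
  assumes "0 \<in> A" "1 \<in> A" "\<And>x y. x \<in> A \<Longrightarrow> y \<in> A \<Longrightarrow> x + y \<in> A"
    "\<And>x y. x \<in> A \<Longrightarrow> y \<in> A \<Longrightarrow> x * y \<in> A" "\<And>x. x \<in> A \<Longrightarrow> - x \<in> A"
  shows "is_subfield A"
proof -
  have "inverse x \<in> A" if "x \<in> A" "x \<noteq> 0" for x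
  proof -
    have "inj_on ((*) x) A" using that by (auto simp: inj_on_def)
    hence "(*) x ` A = A" using that assms by (intro endo_inj_surj) auto
    then obtain y where "y \<in> A" "x * y = 1" using assms(2) by (metis imageE)
    thus ?thesis by (metis inverse_unique)
  qed
  thus ?thesis unfolding is_subfield_def using assms by (metis inverse_zero)
qed

text \<open>For nonzero \<mu> this is the intersection of \<open>S\<close> with
  \<open>inverse \<mu>\<close> times \<open>S\<close>; iterating it measures how far
  \<open>S\<close> is from being \<mu>-invariant.\<close>

definition shift_core :: "'a::field \<Rightarrow> 'a set \<Rightarrow> 'a set" where
  "shift_core \<mu> S = {x \<in> S. \<mu> * x \<in> S}"

text \<open>Depends on \<open>K\<close> alone, so that field and plane become instances of
  \<open>subfield_space\<close> together; later proofs interpret it again at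
  \<open>adjoin K \<mu>\<close> to have dimensions over the extension.\<close>

locale finite_subfield =
  fixes K :: "'a::{field, finite} set"
  assumes subfield: "is_subfield K"
begin

sublocale line: subfield_space "(*)" K
  using subfield by unfold_locales (auto simp: algebra_simps)

sublocale plane_K: subfield_space plane.scale K
  using subfield by unfold_locales

section \<open>Simple extensions of the subfield\<close>

lemma is_subfield_adjoin: "is_subfield (adjoin K \<mu>)"
  unfolding adjoin_def by (rule hull_in) (auto simp: is_subfield_def)

lemma adjoin_superset: "insert \<mu> K \<subseteq> adjoin K \<mu>"
  unfolding adjoin_def by (rule hull_subset)

lemma adjoin_least: "is_subfield A \<Longrightarrow> insert \<mu> K \<subseteq> A \<Longrightarrow> adjoin K \<mu> \<subseteq> A"
  unfolding adjoin_def by (rule hull_minimal)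

lemma subspace_over_superfield:
  assumes "is_subfield L" "K \<subseteq> L"
  shows "subspace_over (*) K L"
  using is_subfieldD[OF assms(1)] assms(2) by (auto simp: subspace_over_def)

lemma subspace_over_mono:
  "subspace_over s L V \<Longrightarrow> K \<subseteq> L \<Longrightarrow> subspace_over s K V"
  by (auto simp: subspace_over_def)

lemma subspace_over_image_mult:
  assumes V: "subspace_over (*) K V"
  shows "subspace_over (*) K ((*) b ` V)"
  unfolding subspace_over_def
proof (intro conjI ballI)
  have "b * 0 \<in> (*) b ` V" by (intro imageI subspace_overD(1)[OF V])
  thus "0 \<in> (*) b ` V" by simp
next
  fix x y assume "x \<in> (*) b ` V" "y \<in> (*) b ` V"
  then obtain x' y' where "x = b * x'" "x' \<in> V" "y = b * y'" "y' \<in> V" by blast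
  moreover from this have "b * (x' + y') \<in> (*) b ` V" by (intro imageI subspace_overD(2)[OF V])
  ultimately show "x + y \<in> (*) b ` V" by (simp add: distrib_left)
next
  fix c x assume "c \<in> K" "x \<in> (*) b ` V"
  then obtain x' where "x = b * x'" "x' \<in> V" by blast
  moreover from this have "b * (c * x') \<in> (*) b ` V"
    using \<open>c \<in> K\<close> by (intro imageI subspace_overD(3)[OF V])
  ultimately show "c * x \<in> (*) b ` V" by (metis mult.left_commute)
qed

lemma subspace_over_plus:
  assumes A: "subspace_over (*) K A" and B: "subspace_over (*) K B"
  shows "subspace_over (*) K (A + B)"
  unfolding subspace_over_def
proof (intro conjI ballI)
  show "0 \<in> A + B" using set_plus_intro[OF subspace_overD(1)[OF A] subspace_overD(1)[OF B]] by simp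
next
  fix x y assume "x \<in> A + B" "y \<in> A + B"
  then obtain a b c d where "x = a + b" "y = c + d" "a \<in> A" "b \<in> B" "c \<in> A" "d \<in> B"
    by (elim set_plus_elim)
  moreover from this have "x + y = (a + c) + (b + d)" by (simp add: algebra_simps)
  moreover have "(a + c) + (b + d) \<in> A + B"
    using calculation by (intro set_plus_intro subspace_overD(2)[OF A] subspace_overD(2)[OF B])
  ultimately show "x + y \<in> A + B" by metis
next
  fix c x assume "c \<in> K" "x \<in> A + B"
  then obtain a b where "x = a + b" "a \<in> A" "b \<in> B"
    by (elim set_plus_elim)
  moreover from this have "c * a + c * b \<in> A + B"
    using \<open>c \<in> K\<close> by (intro set_plus_intro subspace_overD(3)[OF A] subspace_overD(3)[OF B])
  ultimately show "c * x \<in> A + B" by (simp add: distrib_left)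
qed

section \<open>Spans of consecutive powers and the degree of the extension\<close>

lemma subspace_power_span: "subspace_over (*) K (power_span K \<mu> m)"
  unfolding power_span_def by (rule subspace_over_span)

lemma power_span_0 [simp]: "power_span K \<mu> 0 = {0}"
  unfolding power_span_def using line.span_over_empty by simp

lemma power_span_Suc:
  "power_span K \<mu> (Suc m) = {x + c * \<mu> ^ m | x c. x \<in> power_span K \<mu> m \<and> c \<in> K}"
  unfolding power_span_def lessThan_Suc image_insert by (rule line.span_over_insert)

lemma power_mem_power_span: "i < m \<Longrightarrow> \<mu> ^ i \<in> power_span K \<mu> m"
  unfolding power_span_def by (rule subsetD[OF span_over_superset]) auto

lemma power_span_mono: "m \<le> m' \<Longrightarrow> power_span K \<mu> m \<subseteq> power_span K \<mu> m'"
  unfolding power_span_def span_over_def by (intro hull_mono) auto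

lemma mult_mem_power_span_Suc: "x \<in> power_span K \<mu> m \<Longrightarrow> \<mu> * x \<in> power_span K \<mu> (Suc m)"
proof (induction m arbitrary: x)
  case 0
  thus ?case using subspace_overD(1)[OF subspace_power_span] by simp
next
  case (Suc m)
  then obtain y c where x: "x = y + c * \<mu> ^ m" "y \<in> power_span K \<mu> m" "c \<in> K"
    unfolding power_span_Suc by blast
  hence "\<mu> * x = \<mu> * y + c * \<mu> ^ Suc m" by (simp add: algebra_simps)
  thus ?case using Suc.IH x(2,3) unfolding power_span_Suc[of \<mu> "Suc m"] by blast
qed

lemma power_span_subset_adjoin: "power_span K \<mu> m \<subseteq> adjoin K \<mu>"
proof -
  have "\<mu> ^ i \<in> adjoin K \<mu>" for i
    using adjoin_superset is_subfieldD[OF is_subfield_adjoin] by (induction i) auto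
  moreover have "subspace_over (*) K (adjoin K \<mu>)"
    using adjoin_superset is_subfield_adjoin by (intro subspace_over_superfield) auto
  ultimately show ?thesis
    unfolding power_span_def by (intro span_over_least) auto
qed

text \<open>The scalars that map \<open>V\<close> into itself form a subfield, and it contains
  \<open>K\<close> and \<mu>.\<close>

lemma adjoin_subset_stabilizer:
  assumes V: "subspace_over (*) K V" and "\<And>x. x \<in> V \<Longrightarrow> \<mu> * x \<in> V"
  shows "subspace_over (*) (adjoin K \<mu>) V"
proof -
  let ?A = "{x. \<forall>y\<in>V. x * y \<in> V}"
  have "is_subfield ?A"
    using subspace_overD[OF V] line.subspace_over_uminus[OF V]
    by (intro is_subfield_finiteI) (auto simp: distrib_right mult.assoc)
  moreover have "insert \<mu> K \<subseteq> ?A" using assms subspace_overD(3)[OF V] by auto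
  ultimately have "adjoin K \<mu> \<subseteq> ?A" by (rule adjoin_least)
  thus ?thesis using V by (auto simp: subspace_over_def)
qed

text \<open>If \<open>\<mu> ^ m\<close> depends on lower powers, their span is \<mu>-invariant and
  hence a space over the extension; as it contains 1, it contains the extension.\<close>

lemma adjoin_subset_power_span:
  assumes "\<mu> ^ m \<in> power_span K \<mu> m"
  shows "adjoin K \<mu> \<subseteq> power_span K \<mu> m"
proof
  have "m \<noteq> 0" using assms by (intro notI) auto
  hence one: "1 \<in> power_span K \<mu> m" using power_mem_power_span[of 0 m \<mu>] by auto
  have "\<mu> * x \<in> power_span K \<mu> m" if x: "x \<in> power_span K \<mu> m" for x
  proof -
    obtain y c where "\<mu> * x = y + c * \<mu> ^ m" "y \<in> power_span K \<mu> m" "c \<in> K"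
      using mult_mem_power_span_Suc[OF x] unfolding power_span_Suc by blast
    thus ?thesis
      using assms subspace_overD(2,3)[OF subspace_power_span] by simp
  qed
  hence sub: "subspace_over (*) (adjoin K \<mu>) (power_span K \<mu> m)"
    by (rule adjoin_subset_stabilizer[OF subspace_power_span])
  fix x assume "x \<in> adjoin K \<mu>"
  from subspace_overD(3)[OF sub this one] show "x \<in> power_span K \<mu> m" by simp
qed

lemma exists_card_adjoin: "\<exists>t. card (adjoin K \<mu>) = card K ^ t"
proof
  have "K \<subseteq> adjoin K \<mu>" using adjoin_superset by blast
  from line.card_subspace_over[OF subspace_over_superfield[OF is_subfield_adjoin this]]
  show "card (adjoin K \<mu>) = card K ^ dim_over (*) K (adjoin K \<mu>)" .
qed

text \<open>An early dependence would enclose the extension, of order \<open>card K ^ t\<close>, in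
  a span of order \<open>card K ^ m\<close> with \<open>m < t\<close>.\<close>

lemma card_power_span:
  assumes "card (adjoin K \<mu>) = card K ^ t" "m \<le> t"
  shows "card (power_span K \<mu> m) = card K ^ m"
  using assms(2)
proof (induction m)
  case (Suc m)
  hence IH: "card (power_span K \<mu> m) = card K ^ m" by simp
  have "\<mu> ^ m \<notin> power_span K \<mu> m"
  proof
    assume "\<mu> ^ m \<in> power_span K \<mu> m"
    hence "card (adjoin K \<mu>) \<le> card (power_span K \<mu> m)"
      by (intro card_mono adjoin_subset_power_span) auto
    thus False using IH assms(1) Suc.prems card_subfield_gt_1[OF subfield] by simp
  qed
  thus ?case
    unfolding power_span_Suc by (simp add: line.card_subspace_extend[OF subspace_power_span] IH)
qed simp

lemma power_not_mem_power_span: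
  assumes "card (adjoin K \<mu>) = card K ^ t" "m < t"
  shows "\<mu> ^ m \<notin> power_span K \<mu> m"
proof
  assume "\<mu> ^ m \<in> power_span K \<mu> m"
  hence "card (adjoin K \<mu>) \<le> card (power_span K \<mu> m)"
    by (intro card_mono adjoin_subset_power_span) auto
  thus False using card_power_span[OF assms(1), of m] assms card_subfield_gt_1[OF subfield] by simp
qed

lemma power_span_eq_adjoin:
  assumes "card (adjoin K \<mu>) = card K ^ t"
  shows "power_span K \<mu> t = adjoin K \<mu>"
  using card_power_span[OF assms order_refl] assms
  by (intro card_subset_eq power_span_subset_adjoin) auto

section \<open>Shift cores of codimension one\<close>

lemma subspace_shift_core:
  assumes "subspace_over (*) K S"
  shows "subspace_over (*) K (shift_core \<mu> S)"
  unfolding subspace_over_def shift_core_def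
  using subspace_overD[OF assms] by (simp add: distrib_left mult.left_commute[of \<mu>])

text \<open>Raising \<open>m\<close> by one is an extension by the single vector
  \<open>\<mu> ^ m * b\<close>, the shape that the counting lemmas handle.\<close>

lemma plus_power_span_Suc:
  "A + (*) b ` power_span K \<mu> (Suc m) =
    {x + c * (\<mu> ^ m * b) | x c. x \<in> A + (*) b ` power_span K \<mu> m \<and> c \<in> K}"
proof -
  have *: "a + b * (x + c * \<mu> ^ m) = a + b * x + c * (\<mu> ^ m * b)" for a x c
    by (simp add: algebra_simps)
  show ?thesis
  proof (intro equalityI subsetI)
    fix z assume "z \<in> A + (*) b ` power_span K \<mu> (Suc m)"
    then obtain a x c where "z = a + b * (x + c * \<mu> ^ m)" "a \<in> A" "x \<in> power_span K \<mu> m" "c \<in> K"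
      unfolding set_plus_def power_span_Suc by blast
    thus "z \<in> {x + c * (\<mu> ^ m * b) | x c. x \<in> A + (*) b ` power_span K \<mu> m \<and> c \<in> K}"
      unfolding * by blast
  next
    fix z assume "z \<in> {x + c * (\<mu> ^ m * b) | x c. x \<in> A + (*) b ` power_span K \<mu> m \<and> c \<in> K}"
    then obtain a x c where "z = a + b * x + c * (\<mu> ^ m * b)" "a \<in> A" "x \<in> power_span K \<mu> m" "c \<in> K"
      unfolding set_plus_def by blast
    thus "z \<in> A + (*) b ` power_span K \<mu> (Suc m)"
      unfolding *[symmetric] set_plus_def power_span_Suc by blast
  qed
qed

text \<open>
  If the shift core \<open>W\<close> has codimension one in \<open>S\<close>, then so has the shift core of \<open>W\<close> in \<open>W\<close>, unless
  \<open>W\<close> is already invariant: multiplication by \<open>\<mu>\<close> embeds the second quotient into the first. Going up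
  again, each step adds one vector \<open>\<mu> ^ m * b\<close>.
\<close>

lemma shift_core_structure:
  assumes "subspace_over (*) K S" and "shift_core \<mu> S \<noteq> S"
    and "\<And>u v. u \<in> S \<Longrightarrow> v \<in> S - shift_core \<mu> S \<Longrightarrow> \<exists>c\<in>K. u - c * v \<in> shift_core \<mu> S"
  shows "\<exists>m A b. m > 0 \<and> subspace_over (*) K A \<and> (\<forall>x\<in>A. \<mu> * x \<in> A) \<and>
    S = A + (*) b ` power_span K \<mu> m \<and> \<mu> ^ m * b \<notin> S"
  using assms
proof (induction "card S" arbitrary: S rule: less_induct)
  case less
  let ?W = "shift_core \<mu> S"
  have sub: "?W \<subseteq> S" by (auto simp: shift_core_def)
  have W: "subspace_over (*) K ?W" using less.prems(1) by (rule subspace_shift_core)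
  have extend: "S = {x + c * v | x c. x \<in> ?W \<and> c \<in> K}" if v: "v \<in> S - ?W" for v
  proof (intro equalityI subsetI)
    fix u assume "u \<in> S"
    then obtain c where "c \<in> K" "u - c * v \<in> ?W" using less.prems(3) v by blast
    moreover have "u = (u - c * v) + c * v" by simp
    ultimately show "u \<in> {x + c * v | x c. x \<in> ?W \<and> c \<in> K}" by blast
  qed (use sub v subspace_overD(2,3)[OF less.prems(1)] in blast)
  show ?case
  proof (cases "shift_core \<mu> ?W = ?W")
    case True
    \<comment> \<open>An invariant core ends the descent: \<open>A = ?W\<close>,
      \<open>m = 1\<close>, and any \<open>v\<close> outside the core serves as
      \<open>b\<close>.\<close>
    obtain v where v: "v \<in> S - ?W" using less.prems(2) sub by blast
    have "?W + (*) v ` power_span K \<mu> 1 = {x + c * v | x c. x \<in> ?W \<and> c \<in> K}"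
      using plus_power_span_Suc[of ?W v \<mu> 0] by (simp add: set_plus_def)
    hence "S = ?W + (*) v ` power_span K \<mu> 1" using extend[OF v] by simp
    moreover have "\<forall>x\<in>?W. \<mu> * x \<in> ?W" using True by (auto simp: shift_core_def)
    moreover have "\<mu> ^ 1 * v \<notin> S" using v by (auto simp: shift_core_def)
    ultimately show ?thesis using W by blast
  next
    case False
    have "card ?W < card S" using sub less.prems(2) by (intro psubset_card_mono) auto
    \<comment> \<open>The hypothesis for \<open>S\<close>, applied to \<open>\<mu> * u\<close> and
      \<open>\<mu> * v\<close>, gives the one for \<open>?W\<close>: both products lie in
      \<open>S\<close>, and the second lies outside the core.\<close>
    moreover have "\<exists>c\<in>K. u - c * v \<in> shift_core \<mu> ?W" if uv: "u \<in> ?W" "v \<in> ?W - shift_core \<mu> ?W" for u v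
    proof -
      have "\<mu> * u \<in> S" "\<mu> * v \<in> S - ?W" using uv by (auto simp: shift_core_def)
      then obtain c where c: "c \<in> K" "\<mu> * u - c * (\<mu> * v) \<in> ?W" using less.prems(3) by blast
      have "u - c * v \<in> ?W"
        using uv c by (intro line.subspace_over_diff[OF W] subspace_overD(3)[OF W]) auto
      moreover have "\<mu> * (u - c * v) \<in> ?W" using c by (simp add: algebra_simps)
      ultimately show ?thesis using c(1) unfolding shift_core_def by blast
    qed
    ultimately obtain m A b where *: "m > 0" "subspace_over (*) K A" "\<forall>x\<in>A. \<mu> * x \<in> A"
      "?W = A + (*) b ` power_span K \<mu> m" "\<mu> ^ m * b \<notin> ?W"
      using less.hyps[OF _ W False] by blast
    obtain j where m: "m = Suc j" using \<open>m > 0\<close> by (cases m) auto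
    \<comment> \<open>Here \<open>j = m - 1\<close> and the summand 0 comes from \<open>A\<close>.
      Multiplying by \<mu> shows that \<open>\<mu> ^ m * b\<close> lies in \<open>S\<close>; as it
      is not in the core, it is the vector to extend by.\<close>
    have "0 + b * \<mu> ^ j \<in> ?W"
      unfolding *(4) m using *(2) subspace_overD(1) power_mem_power_span
      by (intro set_plus_intro imageI) auto
    hence "\<mu> ^ m * b \<in> S" by (simp add: shift_core_def m algebra_simps)
    hence v: "\<mu> ^ m * b \<in> S - ?W" using * by simp
    have "S = A + (*) b ` power_span K \<mu> (Suc m)"
      unfolding plus_power_span_Suc *(4)[symmetric] by (rule extend[OF v])
    moreover have "\<mu> ^ Suc m * b \<notin> S" using v by (auto simp: shift_core_def mult.assoc)
    ultimately show ?thesis using *(2,3) by blast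
  qed
qed

text \<open>Converse of \<open>shift_core_structure\<close>. The core contains \<open>A\<close> and
  every \<open>\<mu> ^ i * b\<close> with \<open>i < m - 1\<close>, whereas \<mu> moves
  \<open>\<mu> ^ (m - 1) * b\<close> out of \<open>S\<close>; this one vector generates
  \<open>S\<close> over the core.\<close>

lemma card_shift_core:
  assumes A: "subspace_over (*) K A" "\<forall>x\<in>A. \<mu> * x \<in> A" and "m > 0"
    and S: "S = A + (*) b ` power_span K \<mu> m" "\<mu> ^ m * b \<notin> S"
  shows "card S = card K * card (shift_core \<mu> S)"
proof -
  obtain j where m: "m = Suc j" using \<open>m > 0\<close> by (cases m) auto
  have sub: "subspace_over (*) K S"
    unfolding S by (intro subspace_over_plus A subspace_over_image_mult subspace_power_span)
  have W: "subspace_over (*) K (shift_core \<mu> S)" by (rule subspace_shift_core[OF sub])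
  have not_mem: "\<mu> ^ j * b \<notin> shift_core \<mu> S" using S by (auto simp: m shift_core_def mult.assoc)
  have eq: "S = {x + c * (\<mu> ^ j * b) | x c. x \<in> shift_core \<mu> S \<and> c \<in> K}"
  proof (intro equalityI subsetI)
    fix x assume "x \<in> S"
    moreover have "A + (*) b ` power_span K \<mu> j \<subseteq> shift_core \<mu> S"
    proof
      fix y assume "y \<in> A + (*) b ` power_span K \<mu> j"
      then obtain a p where y: "y = a + b * p" "a \<in> A" "p \<in> power_span K \<mu> j"
        unfolding set_plus_def by blast
      have "a + b * p \<in> S"
        unfolding S m using y power_span_mono[of j "Suc j" \<mu>] by (intro set_plus_intro imageI) auto
      moreover have "\<mu> * a + b * (\<mu> * p) \<in> S"
        unfolding S m using y A mult_mem_power_span_Suc by (intro set_plus_intro imageI) auto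
      moreover have "\<mu> * y = \<mu> * a + b * (\<mu> * p)" using y by (simp add: algebra_simps)
      ultimately show "y \<in> shift_core \<mu> S" using y by (simp add: shift_core_def)
    qed
    ultimately show "x \<in> {x + c * (\<mu> ^ j * b) | x c. x \<in> shift_core \<mu> S \<and> c \<in> K}"
      unfolding S(1) m plus_power_span_Suc by blast
  next
    fix x assume "x \<in> {x + c * (\<mu> ^ j * b) | x c. x \<in> shift_core \<mu> S \<and> c \<in> K}"
    then obtain w c where x: "x = w + c * (\<mu> ^ j * b)" "w \<in> S" "c \<in> K"
      by (auto simp: shift_core_def)
    have "0 + b * \<mu> ^ j \<in> S"
      unfolding S m using A subspace_overD(1) power_mem_power_span
      by (intro set_plus_intro imageI) auto
    thus "x \<in> S" using x subspace_overD(2,3)[OF sub] by (simp add: mult.commute)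
  qed
  show ?thesis by (rule trans[OF arg_cong[OF eq, of card] line.card_subspace_extend[OF W not_mem]])
qed

text \<open>The alternatives are the cases \<open>A = {0}\<close> and \<open>A \<noteq> {0}\<close>
  of the structure result. In the second, \<open>t \<le> k - 1\<close> comes from
  \<open>k = t * l + m\<close> with \<open>l\<close> and \<open>m\<close> positive.\<close>

lemma card_shift_core_iff:
  assumes S: "subspace_over (*) K S" and card_S: "card S = card K ^ k" and "k > 0"
    and t: "card (adjoin K \<mu>) = card K ^ t"
  shows "card S = card K * card (shift_core \<mu> S) \<longleftrightarrow>
    (t > k \<and> (\<exists>b. b \<noteq> 0 \<and> S = (*) b ` power_span K \<mu> k)) \<or>
    (t \<le> k - 1 \<and>
     (\<exists>l m. k = t * l + m \<and> m < t \<and> m > 0 \<and>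
       (\<exists>A b. subspace_over (*) (adjoin K \<mu>) A \<and> dim_over (*) (adjoin K \<mu>) A = l \<and>
          b \<noteq> 0 \<and> A \<inter> (*) b ` adjoin K \<mu> = {0} \<and>
          direct_sum_of S A ((*) b ` power_span K \<mu> m))))"
    (is "?L \<longleftrightarrow> ?R1 \<or> ?R2")
proof
  interpret L: finite_subfield "adjoin K \<mu>"
    by unfold_locales (rule is_subfield_adjoin)
  have q: "card K > 1" by (rule card_subfield_gt_1[OF subfield])
  assume ?L
  let ?W = "shift_core \<mu> S"
  have W: "subspace_over (*) K ?W" "?W \<subseteq> S"
    using S subspace_shift_core by (auto simp: shift_core_def)
  have "card S < card K * card S" using card_S q by simp
  hence "?W \<noteq> S" using \<open>?L\<close> by (metis less_irrefl)
  moreover have "\<exists>c\<in>K. u - c * v \<in> ?W" if "u \<in> S" "v \<in> S - ?W" for u v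
  proof -
    have "u \<in> {x + c * v | x c. x \<in> ?W \<and> c \<in> K}"
      using line.codim_1_spanning[OF W(1) S W(2), of v] that \<open>?L\<close> by auto
    then obtain x c where "u = x + c * v" "x \<in> ?W" "c \<in> K" by blast
    thus ?thesis by (intro bexI[of _ c]) auto
  qed
  ultimately obtain m A b where *: "m > 0" "subspace_over (*) K A" "\<forall>x\<in>A. \<mu> * x \<in> A"
    "S = A + (*) b ` power_span K \<mu> m" "\<mu> ^ m * b \<notin> S"
    using shift_core_structure[OF S] by blast
  have A: "subspace_over (*) (adjoin K \<mu>) A"
    using * by (intro adjoin_subset_stabilizer) auto
  have b: "b \<noteq> 0" using * subspace_overD(1)[OF S] by auto
  \<comment> \<open>Otherwise the power span would be the whole extension, which contains
    \<open>\<mu> ^ m\<close>, and \<open>\<mu> ^ m * b\<close> would lie in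
    \<open>S\<close>.\<close>
  have "m < t"
  proof (rule ccontr)
    assume "\<not> m < t"
    hence "adjoin K \<mu> \<subseteq> power_span K \<mu> m"
      using power_span_mono[of t m \<mu>] power_span_eq_adjoin[OF t] by simp
    moreover have "\<mu> ^ m \<in> adjoin K \<mu>"
      using power_mem_power_span[of m "Suc m" \<mu>] power_span_subset_adjoin by blast
    ultimately have "0 + b * \<mu> ^ m \<in> S"
      unfolding *(4) using * subspace_overD(1) by (intro set_plus_intro imageI) auto
    thus False using * by (simp add: mult.commute)
  qed
  \<comment> \<open>Dividing a nonzero common element by its factor in the extension gives
    \<open>b \<in> A\<close>; then \<open>\<mu> ^ m * b\<close> lies in \<open>A\<close> and so in
    \<open>S\<close>, a contradiction.\<close>
  have disj: "A \<inter> (*) b ` adjoin K \<mu> = {0}"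
  proof (intro equalityI subsetI)
    fix x assume "x \<in> A \<inter> (*) b ` adjoin K \<mu>"
    then obtain y where y: "x = b * y" "x \<in> A" "y \<in> adjoin K \<mu>" by blast
    have "y = 0"
    proof (rule ccontr)
      assume "y \<noteq> 0"
      hence "b = inverse y * x" using y by simp
      hence "b \<in> A" using y subspace_overD(3)[OF A] is_subfieldD(6)[OF is_subfield_adjoin] by metis
      moreover have "\<mu> ^ i \<in> adjoin K \<mu>" for i
        using power_mem_power_span[of i "Suc i" \<mu>] power_span_subset_adjoin by blast
      ultimately have "\<mu> ^ m * b + b * 0 \<in> S"
        unfolding *(4) using subspace_overD(3)[OF A] subspace_overD(1)[OF subspace_power_span]
        by (intro set_plus_intro imageI) auto
      thus False using * by simp
    qed
    thus "x \<in> {0}" using y by simp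
  qed (use subspace_overD(1)[OF A] is_subfieldD(1)[OF is_subfield_adjoin] in force)
  have bP: "subspace_over (*) K ((*) b ` power_span K \<mu> m)"
    by (intro subspace_over_image_mult subspace_power_span)
  have disj': "A \<inter> (*) b ` power_span K \<mu> m = {0}"
    using disj power_span_subset_adjoin[of \<mu> m] subspace_overD(1)[OF *(2)] subspace_overD(1)[OF bP]
    by blast
  define l where "l = dim_over (*) (adjoin K \<mu>) A"
  have "card S = card A * card ((*) b ` power_span K \<mu> m)"
    using *(2,4) bP disj' by (simp add: line.card_direct_sum)
  also have "card ((*) b ` power_span K \<mu> m) = card K ^ m"
    using b t card_power_span[of \<mu> t m] \<open>m < t\<close> by (subst card_image) (auto simp: inj_on_def)
  also have card_A: "card A = card K ^ (t * l)"
    using L.line.card_subspace_over[OF A] t by (simp add: l_def power_mult)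
  finally have k: "k = t * l + m"
    using card_S q by (simp flip: power_add)
  show "?R1 \<or> ?R2"
  proof (cases "l = 0")
    case True
    hence "card A = 1" using card_A by simp
    hence "A = {0}" using subspace_overD(1)[OF A] by (metis card_1_singletonE singletonD)
    hence "S = (*) b ` power_span K \<mu> k" using *(4) k True by (auto simp: set_plus_def)
    thus ?thesis using k True \<open>m < t\<close> b by auto
  next
    case False
    hence "t * l \<ge> t" by (cases l) auto
    hence "t \<le> k - 1" using k \<open>m > 0\<close> by linarith
    moreover have "direct_sum_of S A ((*) b ` power_span K \<mu> m)"
      using *(4) disj' by (simp add: direct_sum_of_def)
    ultimately show ?thesis
      using k \<open>m < t\<close> \<open>m > 0\<close> A l_def b disj by blast
  qed
next
  \<comment> \<open>Covers both alternatives: the first is the case \<open>A = {0}\<close> and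
    \<open>m = k\<close>.\<close>
  have *: "card S = card K * card (shift_core \<mu> S)"
    if "m < t" "m > 0" and A: "subspace_over (*) (adjoin K \<mu>) A"
      and b: "b \<noteq> 0" "A \<inter> (*) b ` adjoin K \<mu> = {0}" and S: "S = A + (*) b ` power_span K \<mu> m"
    for m A b
  proof (rule card_shift_core[OF _ _ \<open>m > 0\<close> S])
    show "subspace_over (*) K A" using A adjoin_superset by (rule_tac subspace_over_mono) auto
    show "\<forall>x\<in>A. \<mu> * x \<in> A" using subspace_overD(3)[OF A] adjoin_superset by auto
    \<comment> \<open>Membership would put \<open>b * (\<mu> ^ m - p)\<close> into \<open>A\<close>
      for some \<open>p\<close> in the power span; by disjointness \<open>\<mu> ^ m = p\<close>,
      contrary to \<open>m < t\<close>.\<close>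
    show "\<mu> ^ m * b \<notin> S"
    proof
      assume "\<mu> ^ m * b \<in> S"
      then obtain a p where ap: "\<mu> ^ m * b = a + b * p" "a \<in> A" "p \<in> power_span K \<mu> m"
        unfolding S set_plus_def by blast
      have "\<mu> ^ m \<in> adjoin K \<mu>" "p \<in> adjoin K \<mu>"
        using power_mem_power_span[of m "Suc m" \<mu>] power_span_subset_adjoin[of \<mu>] ap(3) by blast+
      hence "\<mu> ^ m - p \<in> adjoin K \<mu>" using is_subfieldD(7)[OF is_subfield_adjoin] by blast
      moreover have "a = b * (\<mu> ^ m - p)" using ap by (simp add: algebra_simps)
      ultimately have "a = 0" using b(2) ap(2) by blast
      hence "\<mu> ^ m = p" using ap(1) b(1) by (simp add: mult.commute)
      thus False using ap(3) power_not_mem_power_span[OF t \<open>m < t\<close>] by simp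
    qed
  qed
  assume "?R1 \<or> ?R2"
  thus ?L
  proof
    assume ?R1
    then obtain b where b: "t > k" "b \<noteq> 0" "S = (*) b ` power_span K \<mu> k" by blast
    show ?L
    proof (rule *)
      show "S = {0} + (*) b ` power_span K \<mu> k" using b by (auto simp: set_plus_def)
      show "{0} \<inter> (*) b ` adjoin K \<mu> = {0}"
        using is_subfieldD(1)[OF is_subfield_adjoin] by force
    qed (use b \<open>k > 0\<close> in \<open>auto simp: subspace_over_def\<close>)
  next
    assume ?R2
    thus ?L using * unfolding direct_sum_of_def by blast
  qed
qed

end

section \<open>The action of the general linear group on points\<close>

lemma mem_point_iff: "x \<in> plane.p.span {u} \<longleftrightarrow> (\<exists>c. x = plane.scale c u)"
  by (auto simp: plane.p.span_singleton)

lemma mem_point_self: "u \<in> plane.p.span {u}"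
  by (rule plane.p.span_base) simp

lemma point_eqI:
  assumes "x \<in> plane.p.span {u}" "x \<noteq> 0"
  shows "plane.p.span {x} = plane.p.span {u}"
proof -
  obtain c where c: "x = plane.scale c u" using assms(1) mem_point_iff by blast
  with assms(2) have "c \<noteq> 0" by auto
  hence "u = plane.scale (inverse c) x" using c by simp
  hence "u \<in> plane.p.span {x}" unfolding mem_point_iff by blast
  thus ?thesis using assms(1) by (simp add: plane.p.span_eq)
qed

lemma linear_setE:
  assumes "P \<in> linear_set U"
  obtains u where "u \<in> U" "u \<noteq> 0" "P = plane.p.span {u}"
  using assms unfolding linear_set_def by blast

lemma linear_setI: "u \<in> U \<Longrightarrow> u \<noteq> 0 \<Longrightarrow> plane.p.span {u} \<in> linear_set U"
  unfolding linear_set_def by blast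

lemma linear_set_point_eq:
  assumes "P \<in> linear_set U" "x \<in> P" "x \<noteq> 0"
  shows "P = plane.p.span {x}"
  using assms point_eqI by (metis linear_setE)

section \<open>Invertible linear maps and the points they permute\<close>

lemma GL2D:
  assumes "\<phi> \<in> GL2"
  shows "\<phi> (x + y) = \<phi> x + \<phi> y" "\<phi> (plane.scale c x) = plane.scale c (\<phi> x)" "bij \<phi>" "\<phi> 0 = 0"
proof -
  show *: "\<phi> (x + y) = \<phi> x + \<phi> y" "\<phi> (plane.scale c x) = plane.scale c (\<phi> x)" "bij \<phi>" for x y c
    using assms unfolding GL2_def Vector_Spaces.linear_iff by blast+
  show "\<phi> 0 = 0" using *(2)[of 0 0] by simp
qed

lemma GL2I:
  assumes "\<And>x y. \<phi> (x + y) = \<phi> x + \<phi> y" "\<And>c x. \<phi> (plane.scale c x) = plane.scale c (\<phi> x)" "bij \<phi>"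
  shows "\<phi> \<in> GL2"
  using assms plane.p.vector_space_axioms unfolding GL2_def Vector_Spaces.linear_iff by auto

lemma GL2_comp: "\<phi> \<in> GL2 \<Longrightarrow> \<psi> \<in> GL2 \<Longrightarrow> \<psi> \<circ> \<phi> \<in> GL2"
  by (rule GL2I) (simp_all add: GL2D bij_comp)

lemma GL2_eq_0_iff: "\<phi> \<in> GL2 \<Longrightarrow> \<phi> x = 0 \<longleftrightarrow> x = 0"
  using GL2D(3,4) by (metis bij_is_inj injD)

lemma GL2_image_point:
  assumes "\<phi> \<in> GL2"
  shows "\<phi> ` plane.p.span {u} = plane.p.span {\<phi> u}"
  using GL2D(2)[OF assms] by (simp add: plane.p.span_singleton image_image)

lemma linear_set_image_GL2:
  fixes U :: "('a::field \<times> 'a) set"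
  assumes "\<phi> \<in> GL2"
  shows "linear_set (\<phi> ` U) = (`) \<phi> ` linear_set U"
proof -
  have *: "\<phi> ` U - {0} = \<phi> ` (U - {0})" using GL2_eq_0_iff[OF assms] by auto
  have "linear_set V = (\<lambda>u. plane.p.span {u}) ` (V - {0})" for V :: "('a \<times> 'a) set"
    unfolding linear_set_def by blast
  thus ?thesis by (simp add: * image_image GL2_image_point[OF assms])
qed

lemma card_linear_set_image_GL2:
  assumes "\<phi> \<in> GL2"
  shows "card (linear_set (\<phi> ` U)) = card (linear_set U)"
  unfolding linear_set_image_GL2[OF assms]
  using bij_is_inj[OF GL2D(3)[OF assms]] by (intro card_image inj_on_image) (rule inj_on_subset, auto)

lemma subspace_over_image_GL2:
  assumes "\<phi> \<in> GL2" "subspace_over plane.scale K U"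
  shows "subspace_over plane.scale K (\<phi> ` U)"
  unfolding subspace_over_def
proof (intro conjI ballI)
  show "0 \<in> \<phi> ` U" using GL2D(4)[OF assms(1)] subspace_overD(1)[OF assms(2)] by (metis imageI)
next
  fix x y assume "x \<in> \<phi> ` U" "y \<in> \<phi> ` U"
  thus "x + y \<in> \<phi> ` U"
    using GL2D(1)[OF assms(1)] subspace_overD(2)[OF assms(2)] by (auto simp flip: GL2D(1)[OF assms(1)])
next
  fix c x assume "c \<in> K" "x \<in> \<phi> ` U"
  thus "plane.scale c x \<in> \<phi> ` U"
    using subspace_overD(3)[OF assms(2)] by (auto simp flip: GL2D(2)[OF assms(1)])
qed

text \<open>The map sending \<open>p\<close> and \<open>r\<close> to the standard basis, by Cramer's rule.\<close>

lemma exists_GL2_to_axes: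
  assumes "r \<notin> plane.p.span {p}" "p \<noteq> 0"
  shows "\<exists>\<phi>\<in>GL2. \<forall>a b. \<phi> (plane.scale a p + plane.scale b r) = (a, b)"
proof -
  obtain p1 p2 r1 r2 where pr: "p = (p1, p2)" "r = (r1, r2)" by (cases p, cases r)
  define d where "d = p1 * r2 - p2 * r1"
  have "d \<noteq> 0"
  proof
    assume d: "d = 0"
    have "r \<in> plane.p.span {p}"
    proof (cases "p1 = 0")
      case True
      hence "p2 \<noteq> 0" using assms(2) pr by (auto simp: zero_prod_def)
      hence "r = plane.scale (r2 / p2) p"
        using d True by (simp add: pr plane.scale_prod d_def)
      thus ?thesis unfolding mem_point_iff by blast
    next
      case False
      hence "r = plane.scale (r1 / p1) p"
        using d by (simp add: pr plane.scale_prod d_def field_simps)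
      thus ?thesis unfolding mem_point_iff by blast
    qed
    thus False using assms by simp
  qed
  define \<phi> where "\<phi> = (\<lambda>(x, y). ((x * r2 - y * r1) / d, (p1 * y - p2 * x) / d))"
  \<comment> \<open>\<open>\<psi>\<close> sends coordinates to the vector they describe with respect
    to \<open>p\<close> and \<open>r\<close>; it is the inverse of \<open>\<phi>\<close>.\<close>
  define \<psi> where "\<psi> = (\<lambda>(a, b). (a * p1 + b * r1, a * p2 + b * r2))"
  have \<phi>\<psi>: "\<phi> (\<psi> z) = z" for z
  proof -
    obtain a b where z: "z = (a, b)" by (cases z)
    have "(a * p1 + b * r1) * r2 - (a * p2 + b * r2) * r1 = a * d"
      "p1 * (a * p2 + b * r2) - p2 * (a * p1 + b * r1) = b * d"
      by (simp_all add: d_def algebra_simps)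
    thus ?thesis using \<open>d \<noteq> 0\<close> by (simp add: \<phi>_def \<psi>_def z)
  qed
  have \<psi>\<phi>: "\<psi> (\<phi> z) = z" for z
  proof -
    obtain x y where z: "z = (x, y)" by (cases z)
    have "(x * r2 - y * r1) * p1 + (p1 * y - p2 * x) * r1 = x * d"
      "(x * r2 - y * r1) * p2 + (p1 * y - p2 * x) * r2 = y * d"
      by (simp_all add: d_def algebra_simps)
    hence "((x * r2 - y * r1) / d) * p1 + ((p1 * y - p2 * x) / d) * r1 = x"
      "((x * r2 - y * r1) / d) * p2 + ((p1 * y - p2 * x) / d) * r2 = y"
      using \<open>d \<noteq> 0\<close> by (simp_all flip: add_divide_distrib)
    thus ?thesis by (simp add: \<phi>_def \<psi>_def z)
  qed
  have "\<phi> \<in> GL2"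
  proof (rule GL2I)
    show "bij \<phi>" by (rule bij_betw_byWitness[of _ \<psi>]) (auto simp: \<phi>\<psi> \<psi>\<phi>)
    show "\<phi> (x + y) = \<phi> x + \<phi> y" for x y
      by (cases x; cases y) (simp add: \<phi>_def diff_divide_distrib add_divide_distrib algebra_simps)
    show "\<phi> (plane.scale c x) = plane.scale c (\<phi> x)" for c x
      by (cases x) (simp add: \<phi>_def plane.scale_prod diff_divide_distrib algebra_simps)
  qed
  moreover have "plane.scale a p + plane.scale b r = \<psi> (a, b)" for a b
    by (simp add: pr plane.scale_prod \<psi>_def)
  ultimately show ?thesis using \<phi>\<psi> by metis
qed

section \<open>Counting the points of a linear set\<close>

context finite_subfield
begin

lemma subspace_over_point: "subspace_over plane.scale K (plane.p.span X)"
  by (auto simp: subspace_over_def plane.p.span_zero plane.p.span_add plane.p.span_scale)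

text \<open>Distinct points share only the zero vector, so the points partition the nonzero vectors
  of \<open>U\<close>.\<close>

lemma card_linear_set_partition:
  assumes U: "subspace_over plane.scale K U"
  shows "card U - 1 = (\<Sum>P\<in>linear_set U. card (U \<inter> P) - 1)"
proof -
  have "U - {0} = (\<Union>P\<in>linear_set U. U \<inter> P - {0})"
    using linear_setI mem_point_self by blast
  also have "card \<dots> = (\<Sum>P\<in>linear_set U. card (U \<inter> P - {0}))"
  proof (rule card_UN_disjoint)
    show "\<forall>P\<in>linear_set U. \<forall>Q\<in>linear_set U. P \<noteq> Q \<longrightarrow> (U \<inter> P - {0}) \<inter> (U \<inter> Q - {0}) = {}"
      using linear_set_point_eq by blast
  qed auto
  also have "\<dots> = (\<Sum>P\<in>linear_set U. card (U \<inter> P) - 1)"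
  proof (rule sum.cong)
    fix P assume "P \<in> linear_set U"
    hence "0 \<in> P" using plane.p.span_zero by (metis linear_setE)
    thus "card (U \<inter> P - {0}) = card (U \<inter> P) - 1"
      using subspace_overD(1)[OF U] by (simp add: card_Diff_singleton)
  qed simp
  finally show ?thesis using subspace_overD(1)[OF U] by (simp add: card_Diff_singleton)
qed

text \<open>\<open>U \<inter> P\<close> and \<open>U \<inter> Q\<close> meet only in 0, and their
  sum, of order \<open>card K ^ (k + w)\<close>, fits into \<open>U\<close>; hence the weight
  \<open>w\<close> of \<open>Q\<close> is at most two.\<close>

lemma card_points_heavy:
  assumes U: "subspace_over plane.scale K U" "card U = card K ^ (k + 2)"
    and P: "P \<in> linear_set U" "card (U \<inter> P) = card K ^ k"
    and Q: "Q \<in> linear_set U" "Q \<noteq> P"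
  shows "card (U \<inter> Q) = card K \<or> card (U \<inter> Q) = card K ^ 2"
proof -
  have q: "card K > 1" by (rule card_subfield_gt_1[OF subfield])
  have sub: "subspace_over plane.scale K (U \<inter> R)" if "R \<in> linear_set U" for R
    using that U subspace_over_point by (metis linear_setE subspace_over_Int)
  obtain w where w: "card (U \<inter> Q) = card K ^ w"
    using plane_K.card_subspace_over[OF sub[OF Q(1)]] by blast
  obtain u where u: "u \<in> U" "u \<noteq> 0" "Q = plane.p.span {u}" using linear_setE[OF Q(1)] .
  hence "card {0, u} \<le> card (U \<inter> Q)"
    using subspace_overD(1)[OF sub[OF Q(1)]] mem_point_self[of u] by (intro card_mono) auto
  hence "w \<noteq> 0" using u(2) w by (intro notI) auto
  have "U \<inter> P \<inter> (U \<inter> Q) = {0}"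
    using linear_set_point_eq[OF P(1)] linear_set_point_eq[OF Q(1)] Q(2)
      subspace_overD(1)[OF sub[OF Q(1)]] subspace_overD(1)[OF sub[OF P(1)]] by blast
  hence "card (U \<inter> P + U \<inter> Q) = card K ^ k * card K ^ w"
    using plane_K.card_direct_sum[OF sub[OF P(1)] sub[OF Q(1)]] P(2) w by simp
  moreover have "card (U \<inter> P + U \<inter> Q) \<le> card U"
    using subspace_overD(2)[OF U(1)] by (intro card_mono) (auto elim!: set_plus_elim)
  ultimately have "card K ^ (k + w) \<le> card K ^ (k + 2)" using U(2) by (simp add: power_add)
  hence "k + w \<le> k + 2" by (rule power_le_imp_le_exp[OF q])
  hence "w = 1 \<or> w = 2" using \<open>w \<noteq> 0\<close> by linarith
  thus ?thesis using w by auto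
qed

text \<open>
  Every point other than \<open>P\<close> has weight one or two; counting vectors determines the number of points
  from the number of points of weight two.
\<close>

lemma linear_set_count:
  fixes U :: "('a \<times> 'a) set" and k :: nat
  assumes U: "subspace_over plane.scale K U" "card U = card K ^ (k + 2)"
    and P: "P \<in> linear_set U" "card (U \<inter> P) = card K ^ k"
  defines "N1 \<equiv> card {Q \<in> linear_set U - {P}. card (U \<inter> Q) = card K}"
    and "N2 \<equiv> card {Q \<in> linear_set U - {P}. card (U \<inter> Q) = card K ^ 2}"
  shows "card (linear_set U) = 1 + N1 + N2"
    and "N1 + N2 + card K * N2 = card K ^ (k + 1) + card K ^ k"
proof -
  let ?A = "{Q \<in> linear_set U - {P}. card (U \<inter> Q) = card K}"
  let ?B = "{Q \<in> linear_set U - {P}. card (U \<inter> Q) = card K ^ 2}"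
  have q: "card K > 1" by (rule card_subfield_gt_1[OF subfield])
  hence "card K \<noteq> card K ^ 2" using power_inject_exp[of "card K" 1 2] by simp
  hence disj: "P \<notin> ?A \<union> ?B" "?A \<inter> ?B = {}" by auto
  have eq: "linear_set U = insert P (?A \<union> ?B)"
    using card_points_heavy[OF U P] P(1) by blast
  show "card (linear_set U) = 1 + N1 + N2"
    unfolding N1_def N2_def using disj by (subst eq) (simp add: card_Un_disjoint del: Un_iff)
  have "card U - 1 = (\<Sum>Q\<in>insert P (?A \<union> ?B). card (U \<inter> Q) - 1)"
    using card_linear_set_partition[OF U(1)] eq by simp
  also have "\<dots> = (card (U \<inter> P) - 1) + ((\<Sum>Q\<in>?A. card (U \<inter> Q) - 1) + (\<Sum>Q\<in>?B. card (U \<inter> Q) - 1))"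
    using disj by (subst sum.insert) (simp_all add: sum.union_disjoint del: Un_iff)
  also have "(\<Sum>Q\<in>?A. card (U \<inter> Q) - 1) = N1 * (card K - 1)"
    unfolding N1_def by simp
  also have "(\<Sum>Q\<in>?B. card (U \<inter> Q) - 1) = N2 * (card K ^ 2 - 1)"
    unfolding N2_def by simp
  finally have *: "card K ^ (k + 2) - 1 = (card K ^ k - 1) + (N1 * (card K - 1) + N2 * (card K ^ 2 - 1))"
    unfolding U(2) P(2) .
  \<comment> \<open>Over the integers the factor \<open>Z - 1\<close> can be split off and
    cancelled, away from truncated subtraction.\<close>
  define Z where "Z = int (card K)"
  have pos: "card K ^ i \<ge> 1" for i using q by (intro one_le_power) linarith
  have "Z ^ (k + 2) - 1 = (Z ^ k - 1) + (int N1 * (Z - 1) + int N2 * (Z ^ 2 - 1))"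
    using arg_cong[OF *, of int] pos[of k] pos[of "k + 2"] pos[of 2] q
    by (simp add: of_nat_diff Z_def)
  hence "(Z - 1) * (int N1 + int N2 + Z * int N2) = (Z - 1) * (Z ^ (k + 1) + Z ^ k)"
    by (simp add: algebra_simps power2_eq_square)
  moreover have "Z - 1 \<noteq> 0" using q by (simp add: Z_def)
  ultimately have "int N1 + int N2 + Z * int N2 = Z ^ (k + 1) + Z ^ k" by simp
  hence "int (N1 + N2 + card K * N2) = int (card K ^ (k + 1) + card K ^ k)" by (simp add: Z_def)
  thus "N1 + N2 + card K * N2 = card K ^ (k + 1) + card K ^ k" by (simp only: of_nat_eq_iff)
qed

text \<open>By the second identity of \<open>linear_set_count\<close>, \<open>N1 + N2\<close> equals
  \<open>card K ^ (k + 1)\<close> exactly when \<open>card K * N2\<close> equals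
  \<open>card K ^ k\<close>.\<close>

lemma card_linear_set_eq_iff:
  assumes "subspace_over plane.scale K U" "card U = card K ^ (k + 2)"
    and "P \<in> linear_set U" "card (U \<inter> P) = card K ^ k"
  shows "card (linear_set U) = card K ^ (k + 1) + 1 \<longleftrightarrow>
    card K * card {Q \<in> linear_set U - {P}. card (U \<inter> Q) = card K ^ 2} = card K ^ k"
  using linear_set_count[OF assms] by linarith

text \<open>The counts yield a point of weight one: \<open>N1 = 0\<close> would give both
  \<open>N2 = card K ^ (k + 1)\<close> and \<open>card K * N2 = card K ^ k\<close>, which is
  impossible.\<close>

lemma has_minimum_size_iff:
  assumes U: "subspace_over plane.scale K U" "card U = card K ^ (k + 2)"
    and P: "P \<in> linear_set U" "card (U \<inter> P) = card K ^ k"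
  shows "has_minimum_size K U \<longleftrightarrow> card (linear_set U) = card K ^ (k + 1) + 1"
proof -
  have q: "card K > 1" by (rule card_subfield_gt_1[OF subfield])
  have rank: "rank_of K U = k + 2"
    unfolding rank_of_def using plane_K.dim_over_eq_iff[OF U(1)] U(2) by simp
  let ?A = "{Q \<in> linear_set U - {P}. card (U \<inter> Q) = card K}"
  have "\<exists>Q\<in>linear_set U. weight K U Q = 1" if c: "card (linear_set U) = card K ^ (k + 1) + 1"
  proof -
    have "card ?A \<noteq> 0"
    proof
      assume A: "card ?A = 0"
      note count = linear_set_count[OF U P, unfolded A]
      have "card K ^ (k + 1) = card {Q \<in> linear_set U - {P}. card (U \<inter> Q) = card K ^ 2}"
        using c count by linarith
      hence "card K * card K ^ (k + 1) = card K ^ k" using c count by simp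
      hence "card K ^ (k + 2) = card K ^ k" by simp
      thus False using q by (subst (asm) power_inject_exp) auto
    qed
    then obtain Q where Q: "Q \<in> linear_set U" "card (U \<inter> Q) = card K"
      by (metis (mono_tags, lifting) DiffD1 card.empty ex_in_conv mem_Collect_eq)
    have "subspace_over plane.scale K (U \<inter> Q)"
      using Q(1) U subspace_over_point by (metis linear_setE subspace_over_Int)
    hence "weight K U Q = 1" unfolding weight_def using plane_K.dim_over_eq_iff Q(2) by simp
    thus ?thesis using Q(1) by blast
  qed
  thus ?thesis unfolding has_minimum_size_def rank by auto
qed

section \<open>Subspaces of product form\<close>

lemma span_pair: "span_over (*) K {1, \<mu>} = {x + c * \<mu> | x c. x \<in> K \<and> c \<in> K}"
proof -
  have "span_over (*) K {1} = K" by (simp add: line.span_over_insert line.span_over_empty)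
  thus ?thesis by (simp add: insert_commute[of 1] line.span_over_insert[of \<mu> "{1}"])
qed

lemma card_span_pair:
  assumes "\<mu> \<notin> K"
  shows "card (span_over (*) K {1, \<mu>}) = card K ^ 2"
proof -
  have "subspace_over (*) K K" using subspace_over_superfield[OF subfield] by simp
  from line.card_subspace_extend[OF this assms] show ?thesis
    unfolding span_pair by (simp add: power2_eq_square)
qed

text \<open>The points of weight two are the \<open>\<langle>(x, 1)\<rangle>\<close> with \<open>x\<close> in the shift core of \<open>S\<close>.\<close>

lemma card_linear_set_product_iff:
  assumes S: "subspace_over (*) K S" "card S = card K ^ k" and "k > 0" and \<mu>: "\<mu> \<notin> K"
    and U: "subspace_over plane.scale K (S \<times> span_over (*) K {1, \<mu>})"
  shows "card (linear_set (S \<times> span_over (*) K {1, \<mu>})) = card K ^ (k + 1) + 1 \<longleftrightarrow>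
    card S = card K * card (shift_core \<mu> S)"
proof -
  let ?T = "span_over (*) K {1, \<mu>}" and ?P = "plane.p.span {(1, 0)}"
  let ?B = "{Q \<in> linear_set (S \<times> ?T) - {?P}. card (S \<times> ?T \<inter> Q) = card K ^ 2}"
  have q: "card K > 1" by (rule card_subfield_gt_1[OF subfield])
  have T: "subspace_over (*) K ?T" by (rule subspace_over_span)
  have one: "1 \<in> ?T" "\<mu> \<in> ?T" using span_over_superset by blast+
  have card_T: "card ?T = card K ^ 2" by (rule card_span_pair[OF \<mu>])
  have card_U: "card (S \<times> ?T) = card K ^ (k + 2)"
    by (simp add: card_cartesian_product S(2) card_T flip: power_add)
  \<comment> \<open>Since \<open>k > 0\<close>, there is a nonzero \<open>s\<close> in
    \<open>S\<close>, which makes the first axis a point of the linear set; its weight is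
    \<open>k\<close>.\<close>
  have "card S > 1" using S(2) q \<open>k > 0\<close> by (metis one_less_power)
  then obtain s where s: "s \<in> S" "s \<noteq> 0"
    by (metis card_le_Suc0_iff_eq finite less_le_not_le One_nat_def)
  have "plane.p.span {(s, 0)} = ?P"
    using s by (intro point_eqI) (auto simp: mem_point_iff plane.scale_prod zero_prod_def)
  hence P: "?P \<in> linear_set (S \<times> ?T)"
    using linear_setI[of "(s, 0)" "S \<times> ?T"] s subspace_overD(1)[OF T] by (simp add: zero_prod_def)
  have "S \<times> ?T \<inter> ?P = S \<times> {0}"
    using subspace_overD(1)[OF T] by (auto simp: mem_point_iff plane.scale_prod)
  hence card_P: "card (S \<times> ?T \<inter> ?P) = card K ^ k"
    using S(2) by (simp add: card_cartesian_product)
  \<comment> \<open>Any point other than \<open>?P\<close> contains a vector with nonzero second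
    coordinate, which can be scaled to 1, so it is some \<open>pt x\<close>.\<close>
  define pt where "pt x = plane.p.span {(x, 1::'a)}" for x
  have pt_not_P: "pt x \<noteq> ?P" for x
  proof
    assume "pt x = ?P"
    hence "(x, 1) \<in> ?P" using mem_point_self[of "(x, 1)"] by (simp add: pt_def)
    thus False by (auto simp: mem_point_iff plane.scale_prod)
  qed
  have "inj pt"
  proof (rule injI)
    fix x y assume "pt x = pt y"
    hence "(x, 1) \<in> plane.p.span {(y, 1)}" using mem_point_self[of "(x, 1)"] by (simp add: pt_def)
    thus "x = y" by (auto simp: mem_point_iff plane.scale_prod)
  qed
  have Int_pt: "S \<times> ?T \<inter> pt x = (\<lambda>t. (t * x, t)) ` {t \<in> ?T. t * x \<in> S}" for x
    by (auto simp: pt_def mem_point_iff plane.scale_prod)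
  have card_pt: "card (S \<times> ?T \<inter> pt x) = card {t \<in> ?T. t * x \<in> S}" for x
    unfolding Int_pt by (rule card_image) (auto simp: inj_on_def)
  have "?B = pt ` shift_core \<mu> S"
  proof (intro equalityI subsetI)
    fix Q assume "Q \<in> ?B"
    hence Q: "Q \<in> linear_set (S \<times> ?T)" "Q \<noteq> ?P" "card (S \<times> ?T \<inter> Q) = card K ^ 2" by auto
    obtain x t where xt: "(x, t) \<noteq> 0" "Q = plane.p.span {(x, t)}"
      using linear_setE[OF Q(1)] by (metis surj_pair)
    have "t \<noteq> 0"
    proof
      assume "t = 0"
      hence "(x, t) \<in> ?P" by (auto simp: mem_point_iff plane.scale_prod)
      thus False using point_eqI xt Q(2) by blast
    qed
    hence "(x, t) \<in> plane.p.span {(x / t, 1)}"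
      by (auto simp: mem_point_iff plane.scale_prod intro!: exI[of _ t])
    hence Q': "Q = pt (x / t)" using point_eqI xt by (metis pt_def)
    \<comment> \<open>Weight two means that all of \<open>?T\<close> multiplies \<open>x / t\<close>
      into \<open>S\<close>; the elements 1 and \<mu> then witness membership in the core.\<close>
    have "{t' \<in> ?T. t' * (x / t) \<in> S} = ?T"
      using Q(3) card_pt[of "x / t"] card_T unfolding Q' by (intro card_subset_eq) auto
    hence "1 * (x / t) \<in> S" "\<mu> * (x / t) \<in> S" using one by blast+
    hence "x / t \<in> shift_core \<mu> S" by (simp add: shift_core_def)
    thus "Q \<in> pt ` shift_core \<mu> S" using Q' by blast
  next
    fix Q assume "Q \<in> pt ` shift_core \<mu> S"
    then obtain x where x: "x \<in> S" "\<mu> * x \<in> S" "Q = pt x" by (auto simp: shift_core_def)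
    have "t * x \<in> S" if "t \<in> ?T" for t
    proof -
      obtain a c where t: "t = a + c * \<mu>" and "a \<in> K" "c \<in> K" using \<open>t \<in> ?T\<close> unfolding span_pair by blast
      hence "a * x + c * (\<mu> * x) \<in> S"
        using x by (intro subspace_overD(2)[OF S(1)] subspace_overD(3)[OF S(1), of a]
            subspace_overD(3)[OF S(1), of c])
      thus ?thesis unfolding t distrib_right mult.assoc .
    qed
    hence "{t \<in> ?T. t * x \<in> S} = ?T" by blast
    hence "card (S \<times> ?T \<inter> Q) = card K ^ 2" using card_pt[of x] card_T x(3) by simp
    moreover have "Q \<in> linear_set (S \<times> ?T)"
      unfolding x(3) pt_def using x one by (intro linear_setI) (auto simp: zero_prod_def)
    ultimately show "Q \<in> ?B" using pt_not_P x(3) by simp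
  qed
  hence "card ?B = card (shift_core \<mu> S)"
    using \<open>inj pt\<close> by (simp add: card_image inj_on_subset)
  thus ?thesis using card_linear_set_eq_iff[OF U card_U P card_P] S(2) by auto
qed

text \<open>The orders of \<open>U \<inter> P\<close> and \<open>U \<inter> Q\<close> multiply to
  that of \<open>U\<close>, so \<open>U\<close> is their direct sum, and moving \<open>P\<close> and
  \<open>Q\<close> to the axes makes it a product. Choosing the generator \<open>r\<close> of
  \<open>Q\<close> inside \<open>U\<close> puts 1 into the second factor.\<close>

lemma exists_product_form:
  assumes U: "subspace_over plane.scale K U" "card U = card K ^ (k + 2)"
    and P: "P \<in> linear_set U" "card (U \<inter> P) = card K ^ k"
    and Q: "Q \<in> linear_set U" "Q \<noteq> P" "card (U \<inter> Q) = card K ^ 2"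
  shows "\<exists>\<phi>\<in>GL2. \<exists>S \<mu>. \<phi> ` U = S \<times> span_over (*) K {1, \<mu>} \<and>
    subspace_over (*) K S \<and> card S = card K ^ k \<and> \<mu> \<notin> K"
proof -
  have q: "card K > 1" by (rule card_subfield_gt_1[OF subfield])
  obtain p where p: "p \<in> U" "p \<noteq> 0" "P = plane.p.span {p}" using linear_setE[OF P(1)] .
  obtain r where r: "r \<in> U" "r \<noteq> 0" "Q = plane.p.span {r}" using linear_setE[OF Q(1)] .
  have "r \<notin> plane.p.span {p}" using point_eqI[of r p] r p Q(2) by auto
  then obtain \<phi> where \<phi>: "\<phi> \<in> GL2" "\<And>a b. \<phi> (plane.scale a p + plane.scale b r) = (a, b)"
    using exists_GL2_to_axes[OF _ p(2)] by blast
  define S where "S = {a. plane.scale a p \<in> U}"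
  define T where "T = {b. plane.scale b r \<in> U}"
  have sub: "subspace_over (*) K {a. plane.scale a u \<in> U}" for u
    unfolding subspace_over_def
  proof (intro conjI ballI)
    show "0 \<in> {a. plane.scale a u \<in> U}" using subspace_overD(1)[OF U(1)] by simp
  next
    fix x y assume "x \<in> {a. plane.scale a u \<in> U}" "y \<in> {a. plane.scale a u \<in> U}"
    thus "x + y \<in> {a. plane.scale a u \<in> U}"
      using subspace_overD(2)[OF U(1)] by (simp add: plane.p.scale_left_distrib)
  next
    fix c x assume "c \<in> K" "x \<in> {a. plane.scale a u \<in> U}"
    thus "c * x \<in> {a. plane.scale a u \<in> U}"
      using subspace_overD(3)[OF U(1), of c "plane.scale x u"] by simp
  qed
  have inj: "inj_on (\<lambda>a. plane.scale a u) A" if "u \<noteq> 0" for u :: "'a \<times> 'a" and A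
    using that plane.p.scale_cancel_right by (intro inj_onI) blast
  have UP: "U \<inter> P = (\<lambda>a. plane.scale a p) ` S" and UQ: "U \<inter> Q = (\<lambda>b. plane.scale b r) ` T"
    unfolding S_def T_def p(3) r(3) mem_point_iff[abs_def] plane.p.span_singleton by blast+
  have card_S: "card S = card K ^ k" and card_T: "card T = card K ^ 2"
    using P(2) Q(3) inj p(2) r(2) unfolding UP UQ by (simp_all add: card_image)
  have "U \<inter> P \<inter> (U \<inter> Q) = {0}"
    using linear_set_point_eq[OF P(1)] linear_set_point_eq[OF Q(1)] Q(2)
      subspace_overD(1)[OF U(1)] p(3) r(3) plane.p.span_zero by blast
  hence "card (U \<inter> P + U \<inter> Q) = card U"
    using plane_K.card_direct_sum[of "U \<inter> P" "U \<inter> Q"] subspace_over_Int[OF U(1)] subspace_over_point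
      p(3) r(3) P(2) Q(3) U(2) by (simp flip: power_add)
  moreover have "U \<inter> P + U \<inter> Q \<subseteq> U"
    using subspace_overD(2)[OF U(1)] by (auto elim!: set_plus_elim)
  ultimately have sum: "U \<inter> P + U \<inter> Q = U" by (intro card_subset_eq) auto
  have "\<phi> ` (U \<inter> P + U \<inter> Q) = S \<times> T"
    unfolding UP UQ set_plus_image by (auto simp: \<phi>(2) image_iff)
  hence ST: "\<phi> ` U = S \<times> T" by (simp add: sum)
  \<comment> \<open>\<open>T\<close> has order \<open>card K ^ 2\<close>, so it has an element
    outside \<open>K\<close>, which together with 1 spans a subspace of the same order.\<close>
  have "card K < card T" using card_T q by (simp add: power2_eq_square)
  hence "\<not> T \<subseteq> K" by (metis card_mono finite not_le)
  then obtain \<mu> where \<mu>: "\<mu> \<in> T" "\<mu> \<notin> K" by blast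
  have "1 \<in> T" using r(1) by (simp add: T_def)
  hence "span_over (*) K {1, \<mu>} \<subseteq> T"
    using \<mu> sub by (intro span_over_least) (auto simp: T_def)
  hence "span_over (*) K {1, \<mu>} = T"
    using card_span_pair[OF \<mu>(2)] card_T by (intro card_subset_eq) auto
  thus ?thesis using \<phi>(1) ST card_S \<mu>(2) sub[of p] unfolding S_def by blast
qed

end

section \<open>Equivalence with the normal form, and prime extension degree\<close>

theorem theorem3p7:
  fixes Fq :: "'a::{field, finite} set" and U :: "('a \<times> 'a) set" and q n k' :: nat
  assumes "primepow q" and "n > 0" and "k' > 0"
    and "CARD('a) = q ^ n" and "is_subfield Fq" and "card Fq = q"
    and "subspace_over plane.scale Fq U" and "U \<noteq> {0}"
    and "rank_of Fq U = k' + 2"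
    and "\<exists>P\<in>linear_set U. weight Fq U P = k'"
  shows
    "(has_minimum_size Fq U \<longleftrightarrow>
       (\<exists>\<phi>\<in>GL2. \<exists>S T \<mu> t.
          \<phi> ` U = S \<times> T \<and>
          subspace_over (*) Fq S \<and> dim_over (*) Fq S = k' \<and>
          \<mu> \<notin> Fq \<and> T = span_over (*) Fq {1, \<mu>} \<and> card (adjoin Fq \<mu>) = q ^ t \<and>
          ((t > k' \<and> (\<exists>b. b \<noteq> 0 \<and> S = (*) b ` power_span Fq \<mu> k')) \<or>
           (t \<le> k' - 1 \<and>
            (\<exists>l m. k' = t * l + m \<and> m < t \<and> m > 0 \<and>
              (\<exists>S' b. subspace_over (*) (adjoin Fq \<mu>) S' \<and> dim_over (*) (adjoin Fq \<mu>) S' = l \<and>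
                 b \<noteq> 0 \<and> S' \<inter> (*) b ` adjoin Fq \<mu> = {0} \<and>
                 direct_sum_of S S' ((*) b ` power_span Fq \<mu> m)))))))
     \<and>
     (prime n \<and> has_minimum_size Fq U \<longrightarrow>
       (\<exists>\<phi>\<in>GL2. \<exists>\<nu> t\<^sub>1 t\<^sub>2.
          \<nu> \<notin> Fq \<and> {t\<^sub>1, t\<^sub>2} = {2, k'} \<and> t\<^sub>1 + t\<^sub>2 \<le> n + 1 \<and>
          linear_set (\<phi> ` U) = linear_set (power_span Fq \<nu> t\<^sub>1 \<times> power_span Fq \<nu> t\<^sub>2)))"
proof -
  interpret finite_subfield Fq by unfold_locales (rule assms)
  have q: "q = card Fq" using assms by simp
  have q1: "card Fq > 1" by (rule card_subfield_gt_1[OF subfield])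
  have U: "subspace_over plane.scale Fq U" by (rule assms)
  have card_U: "card U = card Fq ^ (k' + 2)"
    using assms(9) plane_K.dim_over_eq_iff[OF U] unfolding rank_of_def by blast
  obtain P where P: "P \<in> linear_set U" "weight Fq U P = k'" using assms(10) by blast
  have "subspace_over plane.scale Fq (U \<inter> P)"
    using P(1) U subspace_over_point by (metis linear_setE subspace_over_Int)
  hence card_P: "card (U \<inter> P) = card Fq ^ k'"
    using P(2) plane_K.dim_over_eq_iff unfolding weight_def by blast
  note min_iff = has_minimum_size_iff[OF U card_U P(1) card_P]
  let ?R1 = "\<lambda>S \<mu> t. t > k' \<and> (\<exists>b. b \<noteq> 0 \<and> S = (*) b ` power_span Fq \<mu> k')"
  let ?R2 = "\<lambda>S \<mu> t. t \<le> k' - 1 \<and>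
            (\<exists>l m. k' = t * l + m \<and> m < t \<and> m > 0 \<and>
              (\<exists>S' b. subspace_over (*) (adjoin Fq \<mu>) S' \<and> dim_over (*) (adjoin Fq \<mu>) S' = l \<and>
                 b \<noteq> 0 \<and> S' \<inter> (*) b ` adjoin Fq \<mu> = {0} \<and>
                 direct_sum_of S S' ((*) b ` power_span Fq \<mu> m)))"
  have forward: "\<exists>\<phi>\<in>GL2. \<exists>S T \<mu> t.
          \<phi> ` U = S \<times> T \<and>
          subspace_over (*) Fq S \<and> dim_over (*) Fq S = k' \<and>
          \<mu> \<notin> Fq \<and> T = span_over (*) Fq {1, \<mu>} \<and> card (adjoin Fq \<mu>) = q ^ t \<and>
          (?R1 S \<mu> t \<or> ?R2 S \<mu> t)" if min: "has_minimum_size Fq U"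
  proof -
    have "card Fq * card {Q \<in> linear_set U - {P}. card (U \<inter> Q) = card Fq ^ 2} = card Fq ^ k'"
      using min min_iff card_linear_set_eq_iff[OF U card_U P(1) card_P] by simp
    \<comment> \<open>The number of these points has a positive multiple, so some point of weight
      two exists to serve as second axis.\<close>
    hence "{Q \<in> linear_set U - {P}. card (U \<inter> Q) = card Fq ^ 2} \<noteq> {}"
      using q1 by (intro notI) (simp only: card.empty, simp)
    then obtain Q where Q: "Q \<in> linear_set U" "Q \<noteq> P" "card (U \<inter> Q) = card Fq ^ 2" by blast
    obtain \<phi> S \<mu> where \<phi>: "\<phi> \<in> GL2" "\<phi> ` U = S \<times> span_over (*) Fq {1, \<mu>}"
      and S: "subspace_over (*) Fq S" "card S = card Fq ^ k'" and \<mu>: "\<mu> \<notin> Fq"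
      using exists_product_form[OF U card_U P(1) card_P Q] by blast
    obtain t where t: "card (adjoin Fq \<mu>) = card Fq ^ t" using exists_card_adjoin by blast
    have "subspace_over plane.scale Fq (S \<times> span_over (*) Fq {1, \<mu>})"
      using subspace_over_image_GL2[OF \<phi>(1) U] \<phi>(2) by simp
    from card_linear_set_product_iff[OF S \<open>k' > 0\<close> \<mu> this]
    have "card S = card Fq * card (shift_core \<mu> S)"
      using min min_iff card_linear_set_image_GL2[OF \<phi>(1), of U] \<phi>(2) by simp
    with card_shift_core_iff[OF S \<open>k' > 0\<close> t] have "?R1 S \<mu> t \<or> ?R2 S \<mu> t" by (rule iffD1)
    moreover have "dim_over (*) Fq S = k'" using line.dim_over_eq_iff[OF S(1)] S(2) by simp
    ultimately have "\<phi> ` U = S \<times> span_over (*) Fq {1, \<mu>} \<and>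
      subspace_over (*) Fq S \<and> dim_over (*) Fq S = k' \<and> \<mu> \<notin> Fq \<and>
      span_over (*) Fq {1, \<mu>} = span_over (*) Fq {1, \<mu>} \<and> card (adjoin Fq \<mu>) = q ^ t \<and>
      (?R1 S \<mu> t \<or> ?R2 S \<mu> t)"
      using \<phi>(2) S(1) \<mu> t unfolding q by (intro conjI refl)
    thus ?thesis using \<phi>(1) by (intro bexI[of _ \<phi>] exI)
  qed
  have backward: "has_minimum_size Fq U"
    if \<phi>: "\<phi> \<in> GL2" "\<phi> ` U = S \<times> T" and S: "subspace_over (*) Fq S" "dim_over (*) Fq S = k'"
      and \<mu>: "\<mu> \<notin> Fq" and T: "T = span_over (*) Fq {1, \<mu>}" and t: "card (adjoin Fq \<mu>) = q ^ t"
      and R: "?R1 S \<mu> t \<or> ?R2 S \<mu> t" for \<phi> S T \<mu> t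
  proof -
    have card_S: "card S = card Fq ^ k'" using S line.dim_over_eq_iff by blast
    have core: "card S = card Fq * card (shift_core \<mu> S)"
      by (rule iffD2[OF card_shift_core_iff[OF S(1) card_S \<open>k' > 0\<close> t[unfolded q]] R])
    have sub: "subspace_over plane.scale Fq (S \<times> span_over (*) Fq {1, \<mu>})"
      using subspace_over_image_GL2[OF \<phi>(1) U] unfolding \<phi>(2) T .
    have "card (linear_set (\<phi> ` U)) = card Fq ^ (k' + 1) + 1"
      unfolding \<phi>(2) T
      by (rule iffD2[OF card_linear_set_product_iff[OF S(1) card_S \<open>k' > 0\<close> \<mu> sub] core])
    thus ?thesis using min_iff card_linear_set_image_GL2[OF \<phi>(1), of U] by simp
  qed
  have prime_case: "\<exists>\<phi>\<in>GL2. \<exists>\<nu> t\<^sub>1 t\<^sub>2.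
          \<nu> \<notin> Fq \<and> {t\<^sub>1, t\<^sub>2} = {2, k'} \<and> t\<^sub>1 + t\<^sub>2 \<le> n + 1 \<and>
          linear_set (\<phi> ` U) = linear_set (power_span Fq \<nu> t\<^sub>1 \<times> power_span Fq \<nu> t\<^sub>2)"
    if n: "prime n" and min: "has_minimum_size Fq U"
  proof -
    obtain \<phi> S T \<mu> t where \<phi>: "\<phi> \<in> GL2" "\<phi> ` U = S \<times> T"
      and \<mu>: "\<mu> \<notin> Fq" and T: "T = span_over (*) Fq {1, \<mu>}" and t: "card (adjoin Fq \<mu>) = q ^ t"
      and R: "?R1 S \<mu> t \<or> ?R2 S \<mu> t"
      using forward[OF min] by (elim bexE exE conjE) (rule that)
    interpret L: finite_subfield "adjoin Fq \<mu>" by unfold_locales (rule is_subfield_adjoin)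
    \<comment> \<open>The whole field is a space over the extension, so \<open>t\<close> divides
      \<open>n\<close>; as \<mu> lies outside \<open>Fq\<close>, primality leaves
      \<open>t = n\<close>.\<close>
    have "subspace_over (*) (adjoin Fq \<mu>) UNIV" by (simp add: subspace_over_def)
    from L.line.card_subspace_over[OF this]
    have "card Fq ^ n = card Fq ^ (t * dim_over (*) (adjoin Fq \<mu>) UNIV)"
      using assms(4) t by (simp add: q power_mult)
    hence "t dvd n" using q1 by simp
    moreover have "t \<noteq> 1"
    proof
      assume "t = 1"
      hence "Fq = adjoin Fq \<mu>" using t adjoin_superset[of \<mu>] by (intro card_subset_eq) (auto simp: q)
      thus False using adjoin_superset[of \<mu>] \<mu> by auto
    qed
    ultimately have "t = n" using n prime_nat_iff by blast
    have adjoin_UNIV: "adjoin Fq \<mu> = UNIV"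
      using t assms(4) unfolding \<open>t = n\<close> by (intro card_subset_eq) auto
    \<comment> \<open>The extension is now the whole field, and so is its multiple by
      \<open>b\<close>. Disjointness forces \<open>A = {0}\<close> and \<open>l = 0\<close>, so
      \<open>k' = m < t\<close>, against \<open>t \<le> k' - 1\<close>.\<close>
    have "\<not> ?R2 S \<mu> t"
    proof
      assume "?R2 S \<mu> t"
      then obtain l m A b where *: "t \<le> k' - 1" "k' = t * l + m" "m < t" "m > 0"
        "subspace_over (*) (adjoin Fq \<mu>) A" "dim_over (*) (adjoin Fq \<mu>) A = l"
        "b \<noteq> 0" "A \<inter> (*) b ` adjoin Fq \<mu> = {0}" by blast
      have "x = b * (inverse b * x)" for x using \<open>b \<noteq> 0\<close> by (simp add: mult.assoc[symmetric])
      hence "(*) b ` adjoin Fq \<mu> = UNIV" unfolding adjoin_UNIV by blast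
      hence "A = {0}" using *(8) by simp
      hence "l = 0" using *(6) L.line.dim_over_eq_iff[OF *(5), of 0] by simp
      thus False using *(1-4) by simp
    qed
    then obtain b where b: "t > k'" "b \<noteq> 0" "S = (*) b ` power_span Fq \<mu> k'" using R by blast
    \<comment> \<open>Rescaling the first coordinate removes the factor \<open>b\<close> from
      \<open>S\<close> and leaves \<open>T\<close> fixed, so even the subspaces coincide, not only
      their linear sets.\<close>
    define \<psi> where "\<psi> = (\<lambda>(x, y :: 'a). (inverse b * x, y))"
    have \<psi>: "\<psi> \<in> GL2"
    proof (rule GL2I)
      show "bij \<psi>"
        by (rule bij_betw_byWitness[of _ "\<lambda>(x, y). (b * x, y)"])
          (auto simp: \<psi>_def b(2) mult.assoc[symmetric])
    qed (auto simp: \<psi>_def plane.scale_prod distrib_left mult.left_commute)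
    have "(*) (inverse b) ` S = power_span Fq \<mu> k'"
      using b(2) by (simp add: b(3) image_image mult.assoc[symmetric])
    moreover have "\<psi> ` (S \<times> T) = (*) (inverse b) ` S \<times> T" by (force simp: \<psi>_def)
    moreover have "power_span Fq \<mu> 2 = T"
      by (simp add: power_span_def T numeral_2_eq_2 lessThan_Suc insert_commute)
    ultimately have "(\<psi> \<circ> \<phi>) ` U = power_span Fq \<mu> k' \<times> power_span Fq \<mu> 2"
      by (simp only: image_comp[symmetric] \<phi>(2))
    moreover have "k' + 2 \<le> n + 1" using b(1) \<open>t = n\<close> by simp
    moreover have "{k', 2} = {2, k'}" by (rule insert_commute)
    ultimately show ?thesis using GL2_comp[OF \<phi>(1) \<psi>] \<mu> by metis
  qed
  show ?thesis
  proof (intro conjI iffI impI)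
    assume "has_minimum_size Fq U"
    thus "\<exists>\<phi>\<in>GL2. \<exists>S T \<mu> t.
          \<phi> ` U = S \<times> T \<and>
          subspace_over (*) Fq S \<and> dim_over (*) Fq S = k' \<and>
          \<mu> \<notin> Fq \<and> T = span_over (*) Fq {1, \<mu>} \<and> card (adjoin Fq \<mu>) = q ^ t \<and>
          (?R1 S \<mu> t \<or> ?R2 S \<mu> t)" by (rule forward)
  next
    assume "\<exists>\<phi>\<in>GL2. \<exists>S T \<mu> t.
          \<phi> ` U = S \<times> T \<and>
          subspace_over (*) Fq S \<and> dim_over (*) Fq S = k' \<and>
          \<mu> \<notin> Fq \<and> T = span_over (*) Fq {1, \<mu>} \<and> card (adjoin Fq \<mu>) = q ^ t \<and>
          (?R1 S \<mu> t \<or> ?R2 S \<mu> t)"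
    thus "has_minimum_size Fq U" by (elim bexE exE conjE) (rule backward)
  next
    assume "prime n \<and> has_minimum_size Fq U"
    thus "\<exists>\<phi>\<in>GL2. \<exists>\<nu> t\<^sub>1 t\<^sub>2.
          \<nu> \<notin> Fq \<and> {t\<^sub>1, t\<^sub>2} = {2, k'} \<and> t\<^sub>1 + t\<^sub>2 \<le> n + 1 \<and>
          linear_set (\<phi> ` U) = linear_set (power_span Fq \<nu> t\<^sub>1 \<times> power_span Fq \<nu> t\<^sub>2)"
      using prime_case by blast
  qed
qed

end
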